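(* Let $G$ be a finitely generated group and let $\rho:[0,\infty)\to[1,\infty)$ be a continuous increasing function. Then the spectral profile functions satisfy $$\widetilde{\boldsymbol\Lambda}_{G,\rho}(v)\ \lesssim\ \Lambda_G(v)\int_0^{1/\Lambda_G(v)^{1/2}}\frac{s\,ds}{\rho(s)} .$$ Further, if $$\rho(t)\simeq\left(\int_t^\infty\frac{ds}{(1+s)\ell(s)}\right)^{-1}$$ where $\ell:[0,\infty)\to[1,\infty)$ is a continuous increasing slowly varying function with $\int_0^\infty \frac{ds}{(1+s)\ell(s)}<\infty$ and such that $\ell(t^a)\simeq\ell(t)$ for all $a>0$, then $$\widetilde{\boldsymbol\Lambda}_{G,\rho}(v)\simeq\frac{1}{\rho(1/\Lambda_G(v))}.$$ In particular, for any integer $k\ge1$ and any $\epsilon>0$, $\widetilde{\boldsymbol\Lambda}_{G,\log_{[k]}^\epsilon}(v)\simeq 1/\log_{[k]}^\epsilon(1/\Lambda_G(v))$.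
   Context: $G$ is equipped with a fixed generating tuple $S=(s_1,\dots,s_k)$; $S^*=\{e,s_1^{\pm1},\dots,s_k^{\pm1}\}$, $|\cdot|$ is the associated word length, and $\mathbf u$ is the uniform probability measure on $S^*$. $|\Omega|$ denotes the cardinality of a set $\Omega$. For a symmetric probability measure $\phi$ on $G$, $\mathcal E_\phi(f,f)=\frac12\sum_{x,y\in G}|f(xy)-f(x)|^2\phi(y)$ and, for $v\geq 1$, $$\Lambda_\phi(v)=\inf\{\mathcal E_\phi(f,f): |\mathrm{support}(f)|\le v,\ \|f\|_2=1\}.$$ $\Lambda_G$ is the $\simeq$-class of $\Lambda_\phi$ for any symmetric $\phi$ with finite generating support; it is represented by $\Lambda_{\mathbf u}$. For $\rho:[0,\infty)\to[1,\infty)$ and a probability measure $\mu$ on $G$, $W(\rho,\mu)=\sup_{s>0}\{s\,\mu(\{g:\rho(|g|)>s\})\}$. $\widetilde{\mathcal S}_{G,\rho}$ is the set of symmetric probability measures $\phi$ on $G$ with $W(\rho,\phi)\le 2\rho(0)$, and $\widetilde{\boldsymbol\Lambda}_{G,\rho}(v)=\sup\{\Lambda_\phi(v):\phi\in\widetilde{\mathcal S}_{G,\rho}\}$. $\log_{[1]}(s)=1+\log(1+s)$ and $\log_{[k]}(s)=1+\log(\log_{[k-1]}(s))$; $\log_{[k]}^\epsilon$ is the $\epsilon$-th power of $\log_{[k]}$. For monotone functions $f,g$ defined near infinity (possibly only on integers, then extended to reals by integer parts), $f\lesssim g$ means that there are constants $c_1,c_2\in(0,\infty)$ with $f(t)\le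 c_1 g(c_2t)$; $f\simeq g$ means $f\lesssim g$ and $g\lesssim f$. When $\Lambda_G(v)=0$ (only possible if $G$ is finite) the right-hand sides are read as $0$. *)

theory Defs
  imports "HOL-Algebra.Generated_Groups" "HOL-Probability.Probability"
begin

definition generating_tuple :: "('a, 'm) monoid_scheme \<Rightarrow> 'a list \<Rightarrow> bool" where
  "generating_tuple G S \<longleftrightarrow> set S \<subseteq> carrier G \<and> generate G (set S) = carrier G"

definition letters :: "('a, 'm) monoid_scheme \<Rightarrow> 'a list \<Rightarrow> 'a set" where
  "letters G S = set S \<union> (\<lambda>s. inv\<^bsub>G\<^esub> s) ` set S"

definition word_length :: "('a, 'm) monoid_scheme \<Rightarrow> 'a list \<Rightarrow> 'a \<Rightarrow> nat" where
  "word_length G S g =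
     (LEAST n. \<exists>w. length w = n \<and> set w \<subseteq> letters G S \<and> foldr (\<lambda>x y. x \<otimes>\<^bsub>G\<^esub> y) w \<one>\<^bsub>G\<^esub> = g)"

text \<open>The uniform measure on the \<^emph>\<open>set\<close> \<open>S\<^sup>*\<close>: repetitions in the tuple carry no extra weight.\<close>

definition unif :: "('a, 'm) monoid_scheme \<Rightarrow> 'a list \<Rightarrow> 'a pmf" where
  "unif G S = pmf_of_set (insert \<one>\<^bsub>G\<^esub> (letters G S))"

text \<open>
  A finitely generated group is countable, so its probability measures are exactly the
  probability mass functions supported in the carrier.
\<close>

definition symmetric_prob :: "('a, 'm) monoid_scheme \<Rightarrow> 'a pmf \<Rightarrow> bool" where
  "symmetric_prob G \<phi> \<longleftrightarrow>
     set_pmf \<phi> \<subseteq> carrier G \<and> (\<forall>g\<in>carrier G. pmf \<phi> (inv\<^bsub>G\<^esub> g) = pmf \<phi> g)"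

definition dirichlet_form :: "('a, 'm) monoid_scheme \<Rightarrow> 'a pmf \<Rightarrow> ('a \<Rightarrow> real) \<Rightarrow> real" where
  "dirichlet_form G \<phi> f =
     1 / 2 * (\<Sum>\<^sub>\<infinity>(x, y)\<in>carrier G \<times> carrier G. \<bar>f (x \<otimes>\<^bsub>G\<^esub> y) - f x\<bar>\<^sup>2 * pmf \<phi> y)"

definition support :: "('a, 'm) monoid_scheme \<Rightarrow> ('a \<Rightarrow> real) \<Rightarrow> 'a set" where
  "support G f = {x \<in> carrier G. f x \<noteq> 0}"

definition norm2 :: "('a, 'm) monoid_scheme \<Rightarrow> ('a \<Rightarrow> real) \<Rightarrow> real" where
  "norm2 G f = sqrt (\<Sum>\<^sub>\<infinity>x\<in>carrier G. \<bar>f x\<bar>\<^sup>2)"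

text \<open>
  Meaningful for \<open>v \<ge> 1\<close>, where the infimum is over a nonempty set of nonnegative numbers.
  For real \<open>v\<close> the value is that at the integer part of \<open>v\<close>.
\<close>

definition spectral_profile :: "('a, 'm) monoid_scheme \<Rightarrow> 'a pmf \<Rightarrow> real \<Rightarrow> real" where
  "spectral_profile G \<phi> v =
     Inf {dirichlet_form G \<phi> f | f.
            finite (support G f) \<and> real (card (support G f)) \<le> v \<and> norm2 G f = 1}"

text \<open>The representative \<open>\<Lambda>\<^bsub>u\<^esub>\<close> of the class \<open>\<Lambda>\<^bsub>G\<^esub>\<close>.\<close>

definition Lambda :: "('a, 'm) monoid_scheme \<Rightarrow> 'a list \<Rightarrow> real \<Rightarrow> real" where
  "Lambda G S = spectral_profile G (unif G S)"

definition weak_moment ::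
    "('a, 'm) monoid_scheme \<Rightarrow> 'a list \<Rightarrow> (real \<Rightarrow> real) \<Rightarrow> 'a pmf \<Rightarrow> ennreal" where
  "weak_moment G S \<rho> \<mu> =
     (SUP s\<in>{0<..}. ennreal s *
        emeasure (measure_pmf \<mu>) {g \<in> carrier G. \<rho> (real (word_length G S g)) > s})"

definition low_moment_measures ::
    "('a, 'm) monoid_scheme \<Rightarrow> 'a list \<Rightarrow> (real \<Rightarrow> real) \<Rightarrow> 'a pmf set" where
  "low_moment_measures G S \<rho> =
     {\<phi>. symmetric_prob G \<phi> \<and> weak_moment G S \<rho> \<phi> \<le> ennreal (2 * \<rho> 0)}"

text \<open>
  If \<open>v \<ge> 1\<close> and \<open>\<rho> 0 \<ge> 1\<close>, the supremum is over a nonempty set (the point mass at the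
  identity qualifies) which is bounded above by \<open>1\<close> (test with the indicator of the identity).
\<close>

definition Lambda_tilde ::
    "('a, 'm) monoid_scheme \<Rightarrow> 'a list \<Rightarrow> (real \<Rightarrow> real) \<Rightarrow> real \<Rightarrow> real" where
  "Lambda_tilde G S \<rho> v = (SUP \<phi>\<in>low_moment_measures G S \<rho>. spectral_profile G \<phi> v)"

definition dominated :: "(real \<Rightarrow> real) \<Rightarrow> (real \<Rightarrow> real) \<Rightarrow> bool" where
  "dominated f g \<longleftrightarrow> (\<exists>c1>0. \<exists>c2>0. eventually (\<lambda>t. f t \<le> c1 * g (c2 * t)) at_top)"

definition dom_equiv :: "(real \<Rightarrow> real) \<Rightarrow> (real \<Rightarrow> real) \<Rightarrow> bool" where
  "dom_equiv f g \<longleftrightarrow> dominated f g \<and> dominated g f"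

text \<open>
  Continuous increasing functions from \<open>[0,\<infinity>)\<close> to \<open>[1,\<infinity>)\<close>; increasing is understood in
  the weak sense. Values at negative arguments are irrelevant.
\<close>

definition admissible :: "(real \<Rightarrow> real) \<Rightarrow> bool" where
  "admissible \<rho> \<longleftrightarrow> continuous_on {0..} \<rho> \<and> mono_on {0..} \<rho> \<and> (\<forall>t\<ge>0. \<rho> t \<ge> 1)"

definition slowly_varying :: "(real \<Rightarrow> real) \<Rightarrow> bool" where
  "slowly_varying l \<longleftrightarrow> (\<forall>c>0. ((\<lambda>t. l (c * t) / l t) \<longlongrightarrow> 1) at_top)"

text \<open>Iterated logarithms; the recursion starts from \<open>1 + s\<close> in order that the value at
  \<open>k = 1\<close> is \<open>1 + ln (1 + s)\<close>.\<close>

primrec iter_log :: "nat \<Rightarrow> real \<Rightarrow> real" where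
  "iter_log 0 s = 1 + s"
| "iter_log (Suc k) s = 1 + ln (iter_log k s)"

end

theory Submission
  imports Defs "HOL-Real_Asymp.Real_Asymp"
begin

text \<open>
  Write \<open>Q(y)\<close> for the displacement \<open>\<parallel>f(\<cdot>y) - f\<parallel>\<^sup>2\<close> of a finitely supported \<open>f\<close>. The Dirichlet form of
  \<open>\<phi>\<close> is half the \<open>\<phi>\<close>-average of \<open>Q\<close>, and the whole proof consists of estimates of \<open>Q\<close>.

  \<^bold>\<open>Upper bound.\<close> One has \<open>Q(y) \<le> 4\<parallel>f\<parallel>\<^sup>2\<close>, and following a geodesic from the identity to \<open>y\<close> gives
  \<open>Q(y) \<le> C |y|\<^sup>2 E\<^sub>u(f)\<close> (\<open>displacement_le_energy\<close>). If \<open>f\<close> nearly minimises \<open>E\<^sub>u\<close> among functions with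
  support of size \<open>v\<close>, then \<open>\<Lambda>\<^sub>\<phi>(v)\<close> is at most a constant times the \<open>\<phi>\<close>-average of
  \<open>min(1, \<Lambda>\<^sub>G(v)|y|\<^sup>2)\<close>. The weak moment condition bounds the tail \<open>\<phi>(|y| \<ge> j)\<close> by \<open>2\<rho>(0)/\<rho>(j)\<close>, and
  summation by parts turns this truncated second moment into the integral of \<open>s/\<rho>(s)\<close> up to
  \<open>\<Lambda>\<^sub>G(v)\<close> to the power \<open>-1/2\<close> (\<open>truncated_second_moment_le\<close>, \<open>spectral_profile_le_integral\<close>).
  A near-minimiser exists as soon as \<open>\<Lambda>\<^sub>G(v) > 0\<close>, which holds on every infinite group; on a finite
  group the constant function shows that all profiles vanish for large \<open>v\<close>.

  \<^bold>\<open>Lower bound.\<close> The supremum defining \<open>Lambda_tilde\<close> is taken separately for every \<open>v\<close>, so the measure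
  may depend on \<open>v\<close>. Take the law of a product of \<open>2n\<close> uniform letters with weight \<open>1/\<rho>(2n)\<close> and put
  the remaining mass at the identity. The support of this law lies in the ball of radius \<open>2n\<close>, so the
  weak moment condition holds (\<open>lazy_walk_low_moment\<close>). With \<open>P\<close> the Markov
  operator of \<open>u\<close>, the Dirichlet form of the \<open>2n\<close>-step law is \<open>\<parallel>f\<parallel>\<^sup>2 - \<parallel>P\<^sup>n f\<parallel>\<^sup>2\<close>. The supports of \<open>P\<^sup>n f\<close>
  grow with \<open>n\<close>, but their \<open>l\<^sup>1\<close>-norms do not, and by truncation the spectral profile controls the energy
  in terms of the ratio of \<open>l\<^sup>1\<close>- and \<open>l\<^sup>2\<close>-norms (\<open>nash_inequality\<close>). Hence \<open>\<parallel>P\<^sup>n f\<parallel>\<^sup>2 \<le> 1/2\<close> for every unit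
  vector \<open>f\<close> with support of size at most \<open>v\<close> once \<open>n\<close> is of order \<open>1/\<Lambda>\<^sub>G(8v)\<close>
  (\<open>markov_iter_decay\<close>), and then \<open>Lambda_tilde\<close> at \<open>v\<close> is at least \<open>1/(2\<rho>(2n))\<close>.

  \<^bold>\<open>Matching the bounds.\<close> If \<open>\<rho>(t\<^sup>2) \<le> D \<rho>(t)\<close> for some constant \<open>D\<close> (\<open>square_doubling\<close>), then \<open>\<rho>\<close> is
  insensitive to dilations and powers of its argument and grows at most linearly, and both bounds are
  comparable with \<open>1/\<rho>(1/\<Lambda>\<^sub>G(v))\<close>. Iterated logarithms and their powers are square doubling by induction.
  For \<open>\<rho>\<close> given by the tail integral of \<open>1/((1+s)l(s))\<close>, the substitution \<open>s = u\<^sup>2\<close> together with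
  \<open>l(u\<^sup>2) \<lesssim> l(u)\<close> shows the same.
\<close>

section \<open>Finitely supported functions and Dirichlet forms\<close>

text \<open>
  A group together with a generating tuple; every infinite sum below runs over the carrier, so values of
  functions outside it are irrelevant.
\<close>

locale marked_group = group G
  for G :: "('a, 'm) monoid_scheme" (structure) +
  fixes S :: "'a list"
  assumes generating: "generating_tuple G S"
begin

abbreviation fin_supp :: "('a \<Rightarrow> real) \<Rightarrow> bool" where
  "fin_supp f \<equiv> finite (support G f)"

definition ip :: "('a \<Rightarrow> real) \<Rightarrow> ('a \<Rightarrow> real) \<Rightarrow> real" where
  "ip f g = (\<Sum>\<^sub>\<infinity>x\<in>carrier G. f x * g x)"

definition translate :: "'a \<Rightarrow> ('a \<Rightarrow> real) \<Rightarrow> 'a \<Rightarrow> real" where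
  "translate y f = (\<lambda>x. f (x \<otimes> y))"

definition displacement :: "('a \<Rightarrow> real) \<Rightarrow> 'a \<Rightarrow> real" where
  "displacement f y = (\<Sum>\<^sub>\<infinity>x\<in>carrier G. (f (x \<otimes> y) - f x)\<^sup>2)"

lemma fin_supp_subset:
  assumes "fin_supp f" "\<And>x. x \<in> carrier G \<Longrightarrow> f x = 0 \<Longrightarrow> g x = 0"
  shows "fin_supp g"
  using assms by (elim finite_subset[rotated]) (auto simp: support_def)

lemma fin_supp_translate:
  assumes "y \<in> carrier G" "fin_supp f"
  shows "fin_supp (translate y f)"
proof -
  have "support G (translate y f) \<subseteq> (\<lambda>x. x \<otimes> inv y) ` support G f"
  proof
    fix x assume x: "x \<in> support G (translate y f)"
    then have "x \<otimes> y \<in> support G f" "x = (x \<otimes> y) \<otimes> inv y"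
      using assms(1) by (auto simp: support_def translate_def m_assoc)
    then show "x \<in> (\<lambda>x. x \<otimes> inv y) ` support G f" by blast
  qed
  then show ?thesis using assms(2) finite_surj by blast
qed

lemma fin_supp_sum:
  assumes "finite A" "\<And>s. s \<in> A \<Longrightarrow> fin_supp (g s)"
  shows "fin_supp (\<lambda>x. \<Sum>s\<in>A. g s x)"
proof -
  have "support G (\<lambda>x. \<Sum>s\<in>A. g s x) \<subseteq> (\<Union>s\<in>A. support G (g s))"
    by (auto simp: support_def dest: sum.not_neutral_contains_not_neutral)
  then show ?thesis using assms by (meson finite_UN finite_subset)
qed

lemma fin_supp_diff:
  assumes "fin_supp f" "fin_supp g"
  shows "fin_supp (\<lambda>x. f x - g x)"
proof -
  have "support G (\<lambda>x. f x - g x) \<subseteq> support G f \<union> support G g"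
    by (auto simp: support_def)
  then show ?thesis using assms by (meson finite_UnI finite_subset)
qed

lemma fin_supp_summable:
  assumes "fin_supp f"
  shows "f summable_on carrier G"
  using assms by (intro finite_nonzero_values_imp_summable_on) (simp add: support_def)

lemma ip_summable:
  assumes "fin_supp f"
  shows "(\<lambda>x. f x * g x) summable_on carrier G"
  by (rule fin_supp_summable, rule fin_supp_subset[OF assms]) simp

lemma ip_commute: "ip f g = ip g f"
  by (simp add: ip_def mult.commute)

lemma ip_self: "ip f f = (\<Sum>\<^sub>\<infinity>x\<in>carrier G. (f x)\<^sup>2)"
  by (simp add: ip_def power2_eq_square)

lemma ip_self_nonneg: "ip f f \<ge> 0"
  unfolding ip_def by (intro infsum_nonneg) simp

lemma ip_add_right:
  assumes "fin_supp f"
  shows "ip f (\<lambda>x. g x + h x) = ip f g + ip f h"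
  unfolding ip_def by (subst infsum_add[symmetric]) (simp_all add: ip_summable assms algebra_simps)

lemma ip_scale_right: "ip f (\<lambda>x. c * g x) = c * ip f g"
  unfolding ip_def by (subst infsum_cmult_right'[symmetric]) (simp add: algebra_simps)

lemma ip_diff_right:
  assumes "fin_supp f"
  shows "ip f (\<lambda>x. g x - h x) = ip f g - ip f h"
  using ip_add_right[OF assms, of g "\<lambda>x. (-1) * h x"] ip_scale_right[of f "-1" h] by simp

lemma ip_sum_right:
  assumes "fin_supp f" "finite A"
  shows "ip f (\<lambda>x. \<Sum>s\<in>A. g s x) = (\<Sum>s\<in>A. ip f (g s))"
  using assms(2)
proof (induction rule: finite_induct)
  case empty
  then show ?case by (simp add: ip_def)
next
  case (insert a A)
  then show ?case using ip_add_right[OF assms(1), of "g a" "\<lambda>x. \<Sum>s\<in>A. g s x"] by simp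
qed

lemma bij_betw_mult_right:
  assumes "y \<in> carrier G"
  shows "bij_betw (\<lambda>x. x \<otimes> y) (carrier G) (carrier G)"
  by (rule bij_betwI[where g = "\<lambda>x. x \<otimes> inv y"]) (use assms in \<open>auto simp: m_assoc\<close>)

lemma ip_translate:
  assumes "y \<in> carrier G"
  shows "ip (translate y f) (translate y g) = ip f g"
  unfolding ip_def translate_def
  using infsum_reindex_bij_betw[OF bij_betw_mult_right[OF assms], of "\<lambda>x. f x * g x"] by simp

lemma ip_cong:
  assumes "\<And>x. x \<in> carrier G \<Longrightarrow> f x = f' x" "\<And>x. x \<in> carrier G \<Longrightarrow> g x = g' x"
  shows "ip f g = ip f' g'"
  unfolding ip_def by (rule infsum_cong) (simp add: assms)

lemma ip_translate_inv:
  assumes "y \<in> carrier G"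
  shows "ip (translate (inv y) f) g = ip f (translate y g)"
proof -
  have "ip (translate (inv y) f) g = ip (translate y (translate (inv y) f)) (translate y g)"
    by (rule ip_translate[OF assms, symmetric])
  also have "\<dots> = ip f (translate y g)"
    by (rule ip_cong) (use assms in \<open>auto simp: translate_def m_assoc\<close>)
  finally show ?thesis .
qed

lemma displacement_summable:
  assumes "fin_supp f" "y \<in> carrier G"
  shows "(\<lambda>x. (f (x \<otimes> y) - f x)\<^sup>2) summable_on carrier G"
proof -
  have "fin_supp (\<lambda>x. translate y f x - f x)"
    by (intro fin_supp_diff fin_supp_translate assms)
  from ip_summable[OF this, of "\<lambda>x. translate y f x - f x"] show ?thesis
    by (simp add: translate_def power2_eq_square)
qed

lemma displacement_nonneg: "displacement f y \<ge> 0"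
  unfolding displacement_def by (intro infsum_nonneg) simp

text \<open>
  Polarisation; right translations are isometries.
\<close>

lemma norm_diff_translates:
  assumes "fin_supp f" "y \<in> carrier G" "z \<in> carrier G"
  shows "ip (\<lambda>x. translate y f x - translate z f x) (\<lambda>x. translate y f x - translate z f x)
       = 2 * ip f f - 2 * ip (translate y f) (translate z f)"
proof -
  have fy: "fin_supp (translate y f)" and fz: "fin_supp (translate z f)"
    using assms by (auto intro: fin_supp_translate)
  have fd: "fin_supp (\<lambda>x. translate y f x - translate z f x)"
    using fy fz by (rule fin_supp_diff)
  show ?thesis
    unfolding ip_diff_right[OF fd]
    unfolding ip_commute[of "\<lambda>x. translate y f x - translate z f x"] 
      ip_diff_right[OF fy] ip_diff_right[OF fz]
    using ip_translate[OF assms(2), of f f] ip_translate[OF assms(3), of f f]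
      ip_commute[of "translate y f" "translate z f"] by simp
qed

lemma displacement_eq:
  assumes "fin_supp f" "y \<in> carrier G"
  shows "displacement f y = 2 * ip f f - 2 * ip f (translate y f)"
proof -
  have "displacement f y =
      ip (\<lambda>x. translate y f x - translate \<one> f x) (\<lambda>x. translate y f x - translate \<one> f x)"
    unfolding displacement_def ip_def
    by (rule infsum_cong) (simp add: translate_def power2_eq_square)
  also have "\<dots> = 2 * ip f f - 2 * ip (translate \<one> f) (translate y f)"
    using norm_diff_translates[OF assms one_closed] ip_commute by simp
  also have "ip (translate \<one> f) (translate y f) = ip f (translate y f)"
    by (rule ip_cong) (auto simp: translate_def)
  finally show ?thesis .
qed

lemma displacement_le:
  assumes "fin_supp f" "y \<in> carrier G"
  shows "displacement f y \<le> 4 * ip f f"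
proof -
  have f2: "fin_supp (\<lambda>x. (f x)\<^sup>2)" by (rule fin_supp_subset[OF assms(1)]) simp
  have f2': "fin_supp (\<lambda>x. (translate y f x)\<^sup>2)"
    by (rule fin_supp_subset[OF fin_supp_translate[OF assms(2,1)]]) simp
  have sm: "(\<lambda>x. 2 * (translate y f x)\<^sup>2) summable_on carrier G" "(\<lambda>x. 2 * (f x)\<^sup>2) summable_on carrier G"
    using fin_supp_summable[OF f2] fin_supp_summable[OF f2'] by (auto intro: summable_on_cmult_right)
  have "displacement f y \<le> (\<Sum>\<^sub>\<infinity>x\<in>carrier G. 2 * (translate y f x)\<^sup>2 + 2 * (f x)\<^sup>2)"
    unfolding displacement_def
  proof (rule infsum_mono)
    show "(\<lambda>x. (f (x \<otimes> y) - f x)\<^sup>2) summable_on carrier G"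
      by (rule displacement_summable[OF assms])
    show "(\<lambda>x. 2 * (translate y f x)\<^sup>2 + 2 * (f x)\<^sup>2) summable_on carrier G"
      using sm by (rule summable_on_add)
    fix x
    have "0 \<le> (f (x \<otimes> y) + f x)\<^sup>2" by simp
    then show "(f (x \<otimes> y) - f x)\<^sup>2 \<le> 2 * (translate y f x)\<^sup>2 + 2 * (f x)\<^sup>2"
      unfolding translate_def by (simp add: power2_eq_square algebra_simps)
  qed
  also have "\<dots> = 2 * ip (translate y f) (translate y f) + 2 * ip f f"
    by (subst infsum_add[OF sm]) (simp add: ip_self infsum_cmult_right')
  finally show ?thesis using ip_translate[OF assms(2)] by simp
qed

text \<open>
  Connects the probabilistic expectation with the unordered sum used in the Dirichlet form.
\<close>

lemma expectation_has_sum: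
  assumes supp: "set_pmf \<phi> \<subseteq> carrier G" and bd: "\<And>y. y \<in> carrier G \<Longrightarrow> \<bar>d y\<bar> \<le> (B::real)"
  shows "((\<lambda>y. d y * pmf \<phi> y) has_sum measure_pmf.expectation \<phi> d) (carrier G)"
proof -
  have "Infinite_Set_Sum.abs_summable_on (\<lambda>y. B * pmf \<phi> y) (carrier G)"
    by (intro abs_summable_on_cmult_right pmf_abs_summable)
  then have abs: "Infinite_Set_Sum.abs_summable_on (\<lambda>y. d y * pmf \<phi> y) (carrier G)"
    by (rule abs_summable_on_comparison_test')
      (auto simp: abs_mult intro!: mult_right_mono bd)
  have "measure_pmf.expectation \<phi> d = infsetsum (\<lambda>y. d y * pmf \<phi> y) UNIV"
    by (simp add: pmf_expectation_eq_infsetsum mult.commute)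
  also have "\<dots> = infsetsum (\<lambda>y. d y * pmf \<phi> y) (carrier G)"
    using supp by (intro infsetsum_cong_neutral) (auto simp: set_pmf_iff)
  also have "\<dots> = infsum (\<lambda>y. d y * pmf \<phi> y) (carrier G)"
    by (rule infsetsum_infsum[OF abs])
  finally have "measure_pmf.expectation \<phi> d = infsum (\<lambda>y. d y * pmf \<phi> y) (carrier G)" .
  moreover have "(\<lambda>y. d y * pmf \<phi> y) summable_on carrier G"
    using abs abs_summable_equivalent abs_summable_summable by blast
  ultimately show ?thesis by (simp add: has_sum_infsum)
qed

text \<open>
  Tonelli: summing over \<open>x\<close> first produces the displacement. All further estimates of Dirichlet forms go
  through this identity, which reduces them to estimates of the displacement.
\<close>

lemma dirichlet_form_eq_expectation:
  assumes "fin_supp f" "set_pmf \<phi> \<subseteq> carrier G"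
  shows "dirichlet_form G \<phi> f = measure_pmf.expectation \<phi> (displacement f) / 2"
proof -
  let ?E = "measure_pmf.expectation \<phi> (displacement f)"
  let ?F = "\<lambda>(y, x). (f (x \<otimes> y) - f x)\<^sup>2 * pmf \<phi> y"
  have outer: "((\<lambda>y. displacement f y * pmf \<phi> y) has_sum ?E) (carrier G)"
    using assms displacement_le displacement_nonneg
    by (intro expectation_has_sum[where B = "4 * ip f f"]) auto
  have inner: "((\<lambda>x. ?F (y, x)) has_sum displacement f y * pmf \<phi> y) (carrier G)"
    if "y \<in> carrier G" for y
    using has_sum_cmult_left[OF has_sum_infsum[OF displacement_summable[OF assms(1) that]]]
    by (simp add: displacement_def)
  have "?F summable_on carrier G \<times> carrier G"
    using inner has_sum_imp_summable[OF outer] by (rule summable_on_SigmaI) auto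
  with inner outer have "(?F has_sum ?E) (carrier G \<times> carrier G)"
    by (rule has_sum_SigmaI)
  then have "((\<lambda>(x, y). (f (x \<otimes> y) - f x)\<^sup>2 * pmf \<phi> y) has_sum ?E) (carrier G \<times> carrier G)"
    by (subst (asm) has_sum_swap) (simp add: case_prod_unfold)
  then show ?thesis
    unfolding dirichlet_form_def by (simp add: infsumI)
qed

section \<open>Word length and spectral profiles\<close>

definition alphabet :: "'a set" where
  "alphabet = insert \<one> (letters G S)"

abbreviation word_product :: "'a list \<Rightarrow> 'a" where
  "word_product w \<equiv> foldr (\<lambda>x y. x \<otimes> y) w \<one>"

abbreviation energy :: "('a \<Rightarrow> real) \<Rightarrow> real" where
  "energy f \<equiv> dirichlet_form G (unif G S) f"

abbreviation q :: real where "q \<equiv> real (card alphabet)"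

lemma letters_carrier: "letters G S \<subseteq> carrier G"
  using generating by (auto simp: letters_def generating_tuple_def)

lemma alphabet_carrier: "alphabet \<subseteq> carrier G"
  using letters_carrier by (auto simp: alphabet_def)

lemma letters_inv: "s \<in> letters G S \<Longrightarrow> inv s \<in> letters G S"
  using generating by (auto simp: letters_def generating_tuple_def)

lemma alphabet_inv: "s \<in> alphabet \<Longrightarrow> inv s \<in> alphabet"
  using letters_inv by (auto simp: alphabet_def)

lemma finite_alphabet: "finite alphabet"
  by (simp add: alphabet_def letters_def)

lemma alphabet_nonempty: "alphabet \<noteq> {}"
  by (simp add: alphabet_def)

lemma q_ge_1: "q \<ge> 1"
  using finite_alphabet alphabet_nonempty by (simp add: Suc_le_eq card_gt_0_iff)

lemma unif_eq: "unif G S = pmf_of_set alphabet"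
  by (simp add: unif_def alphabet_def)

lemma set_unif: "set_pmf (unif G S) = alphabet"
  by (simp add: unif_eq set_pmf_of_set finite_alphabet alphabet_nonempty)

lemma energy_eq:
  assumes "fin_supp f"
  shows "energy f = (\<Sum>s\<in>alphabet. displacement f s) / (2 * q)"
  using dirichlet_form_eq_expectation[OF assms, of "unif G S"] alphabet_carrier
  by (simp add: set_unif) (simp add: unif_eq integral_pmf_of_set finite_alphabet alphabet_nonempty)

lemma word_product_closed: "set w \<subseteq> carrier G \<Longrightarrow> word_product w \<in> carrier G"
  by (induction w) auto

lemma word_product_append:
  assumes "set v \<subseteq> carrier G" "set w \<subseteq> carrier G"
  shows "word_product (v @ w) = word_product v \<otimes> word_product w"
  using assms
  by (induction v) (auto simp: m_assoc word_product_closed simp del: foldr_append)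

lemma word_exists:
  assumes "g \<in> carrier G"
  shows "\<exists>w. set w \<subseteq> letters G S \<and> word_product w = g"
proof -
  have "g \<in> generate G (set S)" using assms generating by (simp add: generating_tuple_def)
  then show ?thesis
  proof (induction rule: generate.induct)
    case one
    show ?case by (rule exI[of _ "[]"]) simp
  next
    case (incl h)
    then show ?case
      using letters_carrier by (intro exI[of _ "[h]"]) (auto simp: letters_def)
  next
    case (inv h)
    then show ?case
      using letters_carrier by (intro exI[of _ "[inv h]"]) (auto simp: letters_def)
  next
    case (eng h1 h2)
    then obtain v w where "set v \<subseteq> letters G S" "word_product v = h1"
      "set w \<subseteq> letters G S" "word_product w = h2" by blast
    then show ?case
      using letters_carrier by (intro exI[of _ "v @ w"]) (simp add: word_product_append del: foldr_append)
  qed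
qed

lemma shortest_word:
  assumes "g \<in> carrier G"
  obtains w where "length w = word_length G S g" "set w \<subseteq> letters G S" "word_product w = g"
proof -
  have "\<exists>n w. length w = n \<and> set w \<subseteq> letters G S \<and> word_product w = g"
    using word_exists[OF assms] by blast
  from LeastI_ex[OF this] show ?thesis
    using that unfolding word_length_def by blast
qed

lemma word_length_le:
  assumes "set w \<subseteq> letters G S"
  shows "word_length G S (word_product w) \<le> length w"
  unfolding word_length_def using assms by (intro Least_le) blast

text \<open>
  Walk to \<open>zy\<close> through \<open>z\<close>. The weights come from \<open>(a+b)\<^sup>2 \<le> (1+n)a\<^sup>2 + (1+1/n)b\<^sup>2\<close>; with \<open>z\<close> a letter and
  \<open>n\<close> the length of \<open>y\<close> they add up, along a word, to the square of its length.
\<close>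

lemma displacement_mult:
  assumes f: "fin_supp f" and "z \<in> carrier G" "y \<in> carrier G" and n: "n > 0"
  shows "displacement f (z \<otimes> y) \<le> (1 + n) * displacement f z + (1 + 1 / n) * displacement f y"
proof -
  have [simp]: "z \<otimes> y \<in> carrier G" using assms by simp
  have shifted: "(\<lambda>x. (f (x \<otimes> z \<otimes> y) - f (x \<otimes> z))\<^sup>2) summable_on carrier G"
    using displacement_summable[OF fin_supp_translate[OF _ f], of z "z \<otimes> y \<otimes> inv z"]
      assms by (auto simp: translate_def m_assoc cong: summable_on_cong)
  have eq: "(\<Sum>\<^sub>\<infinity>x\<in>carrier G. (f (x \<otimes> z \<otimes> y) - f (x \<otimes> z))\<^sup>2) = displacement f y"
    unfolding displacement_def
    by (rule infsum_reindex_bij_betw[OF bij_betw_mult_right[OF assms(2)], of "\<lambda>x. (f (x \<otimes> y) - f x)\<^sup>2"])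
  have sm: "(\<lambda>x. (1 + n) * (f (x \<otimes> z) - f x)\<^sup>2) summable_on carrier G"
    "(\<lambda>x. (1 + 1 / n) * (f (x \<otimes> z \<otimes> y) - f (x \<otimes> z))\<^sup>2) summable_on carrier G"
    using displacement_summable[OF f assms(2)] shifted by (auto intro: summable_on_cmult_right)
  have "displacement f (z \<otimes> y) \<le> (\<Sum>\<^sub>\<infinity>x\<in>carrier G.
      (1 + n) * (f (x \<otimes> z) - f x)\<^sup>2 + (1 + 1 / n) * (f (x \<otimes> z \<otimes> y) - f (x \<otimes> z))\<^sup>2)"
    unfolding displacement_def
  proof (rule infsum_mono)
    show "(\<lambda>x. (f (x \<otimes> (z \<otimes> y)) - f x)\<^sup>2) summable_on carrier G"
      by (rule displacement_summable) (use f in auto)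
    show "(\<lambda>x. (1 + n) * (f (x \<otimes> z) - f x)\<^sup>2 + (1 + 1 / n) * (f (x \<otimes> z \<otimes> y) - f (x \<otimes> z))\<^sup>2)
        summable_on carrier G"
      using sm by (rule summable_on_add)
  next
    fix x assume x: "x \<in> carrier G"
    define a where "a = f (x \<otimes> z) - f x"
    define b where "b = f (x \<otimes> z \<otimes> y) - f (x \<otimes> z)"
    have "f (x \<otimes> (z \<otimes> y)) - f x = a + b" using x assms by (simp add: a_def b_def m_assoc)
    moreover have "(1 + n) * a\<^sup>2 + (1 + 1 / n) * b\<^sup>2 - (a + b)\<^sup>2 = (n * a - b)\<^sup>2 / n"
      using n by (simp add: field_simps power2_eq_square)
    moreover have "(n * a - b)\<^sup>2 / n \<ge> 0" using n by simp
    ultimately have "(f (x \<otimes> (z \<otimes> y)) - f x)\<^sup>2 \<le> (1 + n) * a\<^sup>2 + (1 + 1 / n) * b\<^sup>2"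
      by (metis diff_ge_0_iff_ge)
    then show "(f (x \<otimes> (z \<otimes> y)) - f x)\<^sup>2
        \<le> (1 + n) * (f (x \<otimes> z) - f x)\<^sup>2 + (1 + 1 / n) * (f (x \<otimes> z \<otimes> y) - f (x \<otimes> z))\<^sup>2"
      unfolding a_def b_def .
  qed
  also have "\<dots> = (1 + n) * displacement f z + (1 + 1 / n) * displacement f y"
    by (subst infsum_add[OF sm]) (simp add: infsum_cmult_right' eq displacement_def[of f z])
  finally show ?thesis .
qed

lemma displacement_one: "displacement f \<one> = 0"
proof -
  have "displacement f \<one> = (\<Sum>\<^sub>\<infinity>x\<in>carrier G. 0)"
    unfolding displacement_def by (rule infsum_cong) simp
  then show ?thesis by simp
qed

lemma displacement_word:
  assumes f: "fin_supp f" and m: "\<And>s. s \<in> letters G S \<Longrightarrow> displacement f s \<le> m"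
    and "set w \<subseteq> letters G S"
  shows "displacement f (word_product w) \<le> (real (length w))\<^sup>2 * m"
  using assms(3)
proof (induction w)
  case Nil
  then show ?case by (simp add: displacement_one)
next
  case (Cons s w)
  have s: "s \<in> carrier G" and w: "word_product w \<in> carrier G"
    using Cons.prems letters_carrier by (auto intro!: word_product_closed)
  show ?case
  proof (cases "w = []")
    case True
    then show ?thesis using m Cons.prems s by simp
  next
    case False
    define n where "n = real (length w)"
    have n: "n > 0" using False by (simp add: n_def)
    have "displacement f (s \<otimes> word_product w)
        \<le> (1 + n) * displacement f s + (1 + 1 / n) * displacement f (word_product w)"
      by (rule displacement_mult[OF f s w n])
    also have "\<dots> \<le> (1 + n) * m + (1 + 1 / n) * (n\<^sup>2 * m)"
      using Cons.prems Cons.IH m n by (intro add_mono mult_left_mono) (auto simp: n_def)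
    also have "\<dots> = (n + 1)\<^sup>2 * m"
      using n by (simp add: field_simps power2_eq_square)
    finally show ?thesis by (simp add: n_def algebra_simps)
  qed
qed

text \<open>
  A single letter is displaced by at most \<open>2qE\<^sub>u(f)\<close>, because the energy is an average over the \<open>q\<close> elements
  of the alphabet; a geodesic word then contributes the square of its length.
\<close>

lemma displacement_le_energy:
  assumes f: "fin_supp f" and y: "y \<in> carrier G"
  shows "displacement f y \<le> 2 * q * energy f * (real (word_length G S y))\<^sup>2"
proof -
  have m: "displacement f s \<le> 2 * q * energy f" if "s \<in> letters G S" for s
  proof -
    have "displacement f s \<le> (\<Sum>s\<in>alphabet. displacement f s)"
      using that by (intro member_le_sum displacement_nonneg finite_alphabet) (auto simp: alphabet_def)
    also have "\<dots> = 2 * q * energy f" using q_ge_1 by (simp add: energy_eq[OF f])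
    finally show ?thesis .
  qed
  obtain w where "length w = word_length G S y" "set w \<subseteq> letters G S" "word_product w = y"
    using shortest_word[OF y] .
  with displacement_word[OF f m, where w = w] show ?thesis by (simp add: mult.commute)
qed

lemma dirichlet_form_nonneg: "dirichlet_form G \<phi> f \<ge> 0"
  unfolding dirichlet_form_def by (auto intro!: mult_nonneg_nonneg infsum_nonneg)

lemma norm2_eq: "norm2 G f = sqrt (ip f f)"
  by (simp add: norm2_def ip_self)

lemma norm2_eq_1_iff: "norm2 G f = 1 \<longleftrightarrow> ip f f = 1"
  by (simp add: norm2_eq)

lemma spectral_profile_le:
  assumes "fin_supp f" "real (card (support G f)) \<le> v" "ip f f = 1"
  shows "spectral_profile G \<phi> v \<le> dirichlet_form G \<phi> f"
  unfolding spectral_profile_def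
proof (rule cInf_lower)
  show "bdd_below {dirichlet_form G \<phi> f |f.
      fin_supp f \<and> real (card (support G f)) \<le> v \<and> norm2 G f = 1}"
    by (rule bdd_belowI[of _ 0]) (auto simp: dirichlet_form_nonneg)
qed (use assms norm2_eq_1_iff in blast)

abbreviation \<delta> :: "'a \<Rightarrow> real" where "\<delta> \<equiv> indicator {\<one>}"

lemma support_\<delta>: "support G \<delta> = {\<one>}"
  by (auto simp: support_def indicator_def)

lemma ip_\<delta>: "ip \<delta> \<delta> = 1"
proof -
  have "((\<lambda>x. \<delta> x * \<delta> x) has_sum 1) (carrier G)"
    by (rule has_sum_finite_neutralI[of "{\<one>}"]) (auto simp: indicator_def)
  then show ?thesis unfolding ip_def by (simp add: infsumI)
qed

lemma spectral_profile_greatest: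
  assumes "v \<ge> 1"
    and "\<And>f. fin_supp f \<Longrightarrow> real (card (support G f)) \<le> v \<Longrightarrow> ip f f = 1 \<Longrightarrow> c \<le> dirichlet_form G \<phi> f"
  shows "c \<le> spectral_profile G \<phi> v"
  unfolding spectral_profile_def
proof (rule cInf_greatest)
  have "fin_supp \<delta> \<and> real (card (support G \<delta>)) \<le> v \<and> norm2 G \<delta> = 1"
    using assms(1) by (simp add: support_\<delta> norm2_eq_1_iff ip_\<delta>)
  then show "{dirichlet_form G \<phi> f |f. fin_supp f \<and> real (card (support G f)) \<le> v \<and> norm2 G f = 1} \<noteq> {}"
    by blast
qed (use assms(2) norm2_eq_1_iff in auto)

lemma spectral_profile_nonneg: "v \<ge> 1 \<Longrightarrow> 0 \<le> spectral_profile G \<phi> v"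
  by (rule spectral_profile_greatest) (auto simp: dirichlet_form_nonneg)

lemma expectation_le:
  assumes "set_pmf \<phi> \<subseteq> carrier G" "\<And>y. y \<in> carrier G \<Longrightarrow> \<bar>d y\<bar> \<le> B"
    and "\<And>y. y \<in> carrier G \<Longrightarrow> d y \<le> (c::real)"
  shows "measure_pmf.expectation \<phi> d \<le> c"
proof -
  have ae: "AE y in measure_pmf \<phi>. y \<in> carrier G"
    using assms(1) by (auto simp: AE_measure_pmf_iff)
  show ?thesis
    using ae assms(2,3)
    by (intro measure_pmf.integral_le_const measure_pmf.integrable_const_bound[where B = B])
      (auto elim: eventually_mono)
qed

text \<open>
  Test with the indicator of the identity, whose correlation with any translate is nonnegative.
\<close>

lemma spectral_profile_le_1:
  assumes "set_pmf \<phi> \<subseteq> carrier G" "v \<ge> 1"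
  shows "spectral_profile G \<phi> v \<le> 1"
proof -
  have fin: "fin_supp \<delta>" by (simp add: support_\<delta>)
  have "displacement \<delta> y \<le> 2" if "y \<in> carrier G" for y
  proof -
    have "ip \<delta> (translate y \<delta>) \<ge> 0"
      unfolding ip_def translate_def by (intro infsum_nonneg) simp
    then show ?thesis using displacement_eq[OF fin that] by (simp add: ip_\<delta>)
  qed
  then have "measure_pmf.expectation \<phi> (displacement \<delta>) \<le> 2"
    using displacement_nonneg by (intro expectation_le[OF assms(1), where B = 2]) auto
  then have "dirichlet_form G \<phi> \<delta> \<le> 1"
    by (simp add: dirichlet_form_eq_expectation[OF fin assms(1)])
  then show ?thesis
    using spectral_profile_le[of \<delta> v \<phi>] assms(2) by (simp add: support_\<delta> ip_\<delta>)
qed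

lemma Lambda_le_1: "v \<ge> 1 \<Longrightarrow> Lambda G S v \<le> 1"
  unfolding Lambda_def by (rule spectral_profile_le_1) (simp_all add: set_unif alphabet_carrier)

lemma Lambda_nonneg: "v \<ge> 1 \<Longrightarrow> 0 \<le> Lambda G S v"
  unfolding Lambda_def by (rule spectral_profile_nonneg)

end

section \<open>Admissible moment functions\<close>

lemma admissible_integrable:
  assumes "admissible \<rho>" "0 \<le> a"
  shows "(\<lambda>s. s / \<rho> s) integrable_on {a..b}"
proof (rule integrable_continuous_real)
  have "continuous_on {a..b} \<rho>"
    using assms by (auto simp: admissible_def elim: continuous_on_subset)
  then show "continuous_on {a..b} (\<lambda>s. s / \<rho> s)"
    using assms by (intro continuous_on_divide continuous_on_id)
      (auto simp: admissible_def, smt (verit, best))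
qed

lemma admissible_mono: "admissible \<rho> \<Longrightarrow> 0 \<le> s \<Longrightarrow> s \<le> t \<Longrightarrow> \<rho> s \<le> \<rho> t"
  by (auto simp: admissible_def mono_on_def)

lemma admissible_ge_1: "admissible \<rho> \<Longrightarrow> 0 \<le> t \<Longrightarrow> 1 \<le> \<rho> t"
  by (auto simp: admissible_def)

text \<open>
  The weight \<open>2j+1\<close> is twice the integral of \<open>s\<close> over \<open>[j, j+1]\<close>, and there \<open>\<rho>(s) \<le> \<rho>(j+1)\<close>.
\<close>

lemma sum_odd_div_le_integral:
  assumes \<rho>: "admissible \<rho>"
  shows "(\<Sum>j<M. (2 * real j + 1) / \<rho> (real j + 1)) \<le> 2 * integral {0..real M} (\<lambda>s. s / \<rho> s)"
proof (induction M)
  case 0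
  then show ?case by simp
next
  case (Suc M)
  define n where "n = real M"
  have n: "0 \<le> n" by (simp add: n_def)
  have "((\<lambda>s. s) has_integral ((n + 1)\<^sup>2 / 2 - n\<^sup>2 / 2)) {n..n + 1}"
    by (rule fundamental_theorem_of_calculus)
      (auto intro!: derivative_eq_intros simp: has_real_derivative_iff_has_vector_derivative[symmetric])
  then have int: "((\<lambda>s. s / \<rho> (n + 1)) has_integral ((n + 1)\<^sup>2 / 2 - n\<^sup>2 / 2) / \<rho> (n + 1)) {n..n + 1}"
    by (rule has_integral_divide)
  have "((n + 1)\<^sup>2 / 2 - n\<^sup>2 / 2) / \<rho> (n + 1) \<le> integral {n..n + 1} (\<lambda>s. s / \<rho> s)"
  proof (rule has_integral_le[OF int integrable_integral[OF admissible_integrable[OF \<rho> n]]])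
    fix s assume s: "s \<in> {n..n + 1}"
    have "\<rho> s \<le> \<rho> (n + 1)" "1 \<le> \<rho> s"
      using s n by (auto intro: admissible_mono[OF \<rho>] admissible_ge_1[OF \<rho>])
    then show "s / \<rho> (n + 1) \<le> s / \<rho> s"
      using s n by (intro divide_left_mono) auto
  qed
  moreover have "integral {0..n} (\<lambda>s. s / \<rho> s) + integral {n..n + 1} (\<lambda>s. s / \<rho> s)
      = integral {0..n + 1} (\<lambda>s. s / \<rho> s)"
    by (rule Henstock_Kurzweil_Integration.integral_combine)
      (use n admissible_integrable[OF \<rho>] in auto)
  moreover have "(n + 1)\<^sup>2 / 2 - n\<^sup>2 / 2 = (2 * n + 1) / 2"
    by (simp add: power2_eq_square algebra_simps)
  ultimately have "((2 * n + 1) / 2) / \<rho> (n + 1) + integral {0..n} (\<lambda>s. s / \<rho> s)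
      \<le> integral {0..n + 1} (\<lambda>s. s / \<rho> s)" by simp
  then have "(2 * n + 1) / \<rho> (n + 1) + 2 * integral {0..n} (\<lambda>s. s / \<rho> s)
      \<le> 2 * integral {0..n + 1} (\<lambda>s. s / \<rho> s)" by simp
  then show ?case using Suc.IH by (simp add: n_def add.commute)
qed

text \<open>
  Summation by parts for the truncated square, through \<open>(j+1)\<^sup>2 - j\<^sup>2 = 2j+1\<close>.
\<close>

lemma min_square_eq_sum:
  "(real (min n M))\<^sup>2 = (\<Sum>j<M. (2 * real j + 1) * indicator {k. Suc j \<le> k} n)"
proof (induction M)
  case 0
  then show ?case by simp
next
  case (Suc M)
  show ?case
  proof (cases "Suc M \<le> n")
    case True
    then show ?thesis using Suc by (simp add: min_def power2_eq_square algebra_simps)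
  next
    case False
    then show ?thesis using Suc by (simp add: min_def indicator_def split: if_splits) 
  qed
qed

section \<open>Positivity of the profile on infinite groups\<close>

context marked_group begin

lemma ip_self_eq_sum:
  assumes "fin_supp f"
  shows "ip f f = (\<Sum>x\<in>support G f. (f x)\<^sup>2)"
  unfolding ip_self
  by (rule infsumI, rule has_sum_finite_neutralI[OF assms]) (auto simp: support_def)

text \<open>
  A unit vector with at most \<open>v\<close> points in its support takes a value of square at least \<open>1/v\<close> at some \<open>x\<close>.
  Among any \<open>\<lfloor>v\<rfloor> + 1\<close> fixed group elements \<open>y\<close>, one moves \<open>x\<close> out of the support and therefore has
  displacement at least \<open>1/v\<close>. The word lengths of the chosen elements are bounded, which bounds the energy
  from below.
\<close>

lemma Lambda_pos_if_infinite:
  assumes inf: "infinite (carrier G)" and v: "v \<ge> 1"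
  shows "Lambda G S v > 0"
proof -
  obtain Y where Y: "finite Y" "card Y = Suc (nat \<lfloor>v\<rfloor>)" "Y \<subseteq> carrier G"
    using infinite_arbitrarily_large[OF inf] by blast
  define r where "r = 1 + (\<Sum>y\<in>Y. (real (word_length G S y))\<^sup>2)"
  have r: "r \<ge> 1" by (simp add: r_def sum_nonneg)
  have "1 / (v * (2 * q * r)) \<le> spectral_profile G (unif G S) v"
  proof (rule spectral_profile_greatest[OF v])
    fix f assume f: "fin_supp f" and card: "real (card (support G f)) \<le> v" and norm: "ip f f = 1"
    have "\<exists>x\<in>support G f. 1 / v \<le> (f x)\<^sup>2"
    proof (rule ccontr)
      assume "\<not> ?thesis"
      then have *: "\<And>x. x \<in> support G f \<Longrightarrow> (f x)\<^sup>2 < 1 / v" by force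
      have "support G f \<noteq> {}" using norm ip_self_eq_sum[OF f] by auto
      then have "ip f f < (\<Sum>x\<in>support G f. 1 / v)"
        unfolding ip_self_eq_sum[OF f] using f * by (intro sum_strict_mono) auto
      also have "\<dots> \<le> 1" using card v by simp
      finally show False using norm by simp
    qed
    then obtain x where x: "x \<in> carrier G" "1 / v \<le> (f x)\<^sup>2" by (auto simp: support_def)
    have "inj_on (\<lambda>y. x \<otimes> y) Y" using x Y by (intro inj_onI) (metis Units_eq Units_l_cancel subsetD)
    then have "card ((\<lambda>y. x \<otimes> y) ` Y) = Suc (nat \<lfloor>v\<rfloor>)" using Y by (simp add: card_image)
    moreover have "card (support G f) \<le> nat \<lfloor>v\<rfloor>" using card by (simp add: le_nat_floor)
    ultimately have "\<not> (\<lambda>y. x \<otimes> y) ` Y \<subseteq> support G f"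
      using card_mono[OF f, of "(\<lambda>y. x \<otimes> y) ` Y"] by linarith
    then obtain y where y: "y \<in> Y" "f (x \<otimes> y) = 0" using x Y by (auto simp: support_def)
    have yG: "y \<in> carrier G" using y Y by auto
    have "1 / v \<le> (\<Sum>x\<in>{x}. (f (x \<otimes> y) - f x)\<^sup>2)" using x y by simp
    also have "\<dots> \<le> displacement f y"
      unfolding displacement_def using x
      by (intro finite_sum_le_infsum displacement_summable[OF f yG]) auto
    also have "\<dots> \<le> 2 * q * energy f * (real (word_length G S y))\<^sup>2"
      by (rule displacement_le_energy[OF f yG])
    also have "\<dots> \<le> 2 * q * energy f * r"
    proof (intro mult_left_mono mult_nonneg_nonneg dirichlet_form_nonneg)
      have "(real (word_length G S y))\<^sup>2 \<le> (\<Sum>y\<in>Y. (real (word_length G S y))\<^sup>2)"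
        using y Y by (intro member_le_sum) auto
      then show "(real (word_length G S y))\<^sup>2 \<le> r" by (simp add: r_def)
    qed auto
    finally show "1 / (v * (2 * q * r)) \<le> energy f"
      using v r q_ge_1 by (simp add: field_simps)
  qed
  moreover have "1 / (v * (2 * q * r)) > 0" using v r q_ge_1 by auto
  ultimately show ?thesis unfolding Lambda_def by linarith
qed

lemma spectral_profile_eq_0_if_finite:
  assumes fin: "finite (carrier G)" and v: "v \<ge> real (card (carrier G))"
    and \<phi>: "set_pmf \<phi> \<subseteq> carrier G"
  shows "spectral_profile G \<phi> v = 0"
proof -
  define N where "N = real (card (carrier G))"
  have ne: "carrier G \<noteq> {}" using one_closed by blast
  then have N: "N \<ge> 1" using fin by (simp add: N_def Suc_le_eq card_gt_0_iff)
  define f where "f = (\<lambda>x::'a. 1 / sqrt N)"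
  have supp: "support G f \<subseteq> carrier G" by (auto simp: support_def)
  then have f: "fin_supp f" using fin finite_subset by blast
  have "ip f f = 1" using fin N ne by (simp add: ip_def f_def N_def)
  moreover have "real (card (support G f)) \<le> v" using card_mono[OF fin supp] v by simp
  ultimately have "spectral_profile G \<phi> v \<le> dirichlet_form G \<phi> f"
    using f by (intro spectral_profile_le)
  also have "displacement f = (\<lambda>_. 0)" by (rule ext) (simp add: displacement_def f_def)
  then have "dirichlet_form G \<phi> f = 0" by (simp add: dirichlet_form_eq_expectation[OF f \<phi>])
  finally show ?thesis using spectral_profile_nonneg[of v \<phi>] v N by (simp add: N_def)
qed

section \<open>The upper bound\<close>

text \<open>
  The weak moment condition only speaks of the event \<open>\<rho>(|y|) > s\<close>, which contains \<open>|y| \<ge> j\<close> for every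
  \<open>s < \<rho>(j)\<close>; letting \<open>s\<close> increase to \<open>\<rho>(j)\<close> loses nothing.
\<close>

lemma weak_moment_tail:
  assumes \<rho>: "admissible \<rho>" and \<phi>: "\<phi> \<in> low_moment_measures G S \<rho>"
  shows "measure_pmf.prob \<phi> {y \<in> carrier G. j \<le> word_length G S y} \<le> 2 * \<rho> 0 / \<rho> (real j)"
proof -
  let ?P = "measure_pmf.prob \<phi> {y \<in> carrier G. j \<le> word_length G S y}"
  have \<rho>j: "\<rho> (real j) \<ge> 1" and \<rho>0: "\<rho> 0 \<ge> 1" using admissible_ge_1[OF \<rho>] by auto
  have "\<rho> (real j) * ?P \<le> 2 * \<rho> 0"
  proof (rule field_le_mult_one_interval)
    fix z :: real assume z: "0 < z" "z < 1"
    define s where "s = z * \<rho> (real j)"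
    have s: "0 < s" "s < \<rho> (real j)" using z \<rho>j by (auto simp: s_def)
    have "ennreal s * emeasure (measure_pmf \<phi>) {y \<in> carrier G. j \<le> word_length G S y}
        \<le> ennreal s * emeasure (measure_pmf \<phi>) {y \<in> carrier G. s < \<rho> (real (word_length G S y))}"
      using less_le_trans[OF s(2) admissible_mono[OF \<rho>]]
      by (intro mult_left_mono emeasure_mono) auto
    also have "\<dots> \<le> weak_moment G S \<rho> \<phi>"
      unfolding weak_moment_def using s(1) by (intro SUP_upper) auto
    also have "\<dots> \<le> ennreal (2 * \<rho> 0)" using \<phi> by (simp add: low_moment_measures_def)
    finally have "s * ?P \<le> 2 * \<rho> 0"
      using s(1) \<rho>0 by (simp add: measure_pmf.emeasure_eq_measure ennreal_mult[symmetric])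
    then show "z * (\<rho> (real j) * ?P) \<le> 2 * \<rho> 0" by (simp add: s_def mult.assoc)
  qed
  then show ?thesis using \<rho>j by (simp add: field_simps)
qed

lemma truncated_second_moment_le:
  assumes \<rho>: "admissible \<rho>" and \<phi>: "\<phi> \<in> low_moment_measures G S \<rho>"
  shows "measure_pmf.expectation \<phi> (\<lambda>y. (real (min (word_length G S y) M))\<^sup>2)
      \<le> 4 * \<rho> 0 * integral {0..real M} (\<lambda>s. s / \<rho> s)"
proof -
  have \<rho>0: "\<rho> 0 \<ge> 1" using admissible_ge_1[OF \<rho>] by auto
  have supp: "set_pmf \<phi> \<subseteq> carrier G"
    using \<phi> by (simp add: low_moment_measures_def symmetric_prob_def)
  let ?A = "\<lambda>j. {y \<in> carrier G. Suc j \<le> word_length G S y}"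
  have "measure_pmf.expectation \<phi> (\<lambda>y. (real (min (word_length G S y) M))\<^sup>2)
      = measure_pmf.expectation \<phi> (\<lambda>y. \<Sum>j<M. (2 * real j + 1) * indicator (?A j) y)"
    using supp unfolding min_square_eq_sum
    by (intro integral_cong_AE) (auto simp: AE_measure_pmf_iff indicator_def intro!: sum.cong)
  also have "\<dots> = (\<Sum>j<M. (2 * real j + 1) * measure_pmf.prob \<phi> (?A j))"
    by (subst Bochner_Integration.integral_sum)
      (auto intro!: measure_pmf.integrable_const_bound[where B = 1])
  also have "\<dots> \<le> (\<Sum>j<M. (2 * real j + 1) * (2 * \<rho> 0 / \<rho> (real (Suc j))))"
    by (intro sum_mono mult_left_mono weak_moment_tail[OF \<rho> \<phi>]) auto
  also have "\<dots> = 2 * \<rho> 0 * (\<Sum>j<M. (2 * real j + 1) / \<rho> (real j + 1))"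
    by (simp add: sum_distrib_left add.commute mult_ac)
  also have "\<dots> \<le> 2 * \<rho> 0 * (2 * integral {0..real M} (\<lambda>s. s / \<rho> s))"
    using \<rho>0 by (intro mult_left_mono sum_odd_div_le_integral[OF \<rho>]) auto
  finally show ?thesis by simp
qed

lemma near_optimal:
  assumes "v \<ge> 1" "Lambda G S v > 0"
  obtains f where "fin_supp f" "real (card (support G f)) \<le> v" "ip f f = 1"
    "energy f \<le> 2 * Lambda G S v"
proof (rule ccontr)
  assume "\<not> thesis"
  then have "2 * Lambda G S v \<le> spectral_profile G (unif G S) v"
    using that by (intro spectral_profile_greatest[OF assms(1)]) force
  then show False using assms(2) by (simp add: Lambda_def)
qed

text \<open>
  A function whose energy is within a factor \<open>2\<close> of the infimum serves as test function for every \<open>\<phi>\<close>.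
  The bounds \<open>Q \<le> 4\<close> and \<open>Q(y) \<le> 4q\<Lambda>|y|\<^sup>2\<close> cross over, up to a constant, at
  \<open>|y| = R\<close>, where \<open>R\<close> is \<open>\<Lambda>\<close> to the power \<open>-1/2\<close>.
  Truncating at the integer part \<open>M\<close> of \<open>R\<close> costs a factor \<open>4\<close>, since \<open>R \<le> 2M\<close>, and keeps the integral
  inside \<open>[0, R]\<close>.
\<close>

lemma spectral_profile_le_integral:
  assumes \<rho>: "admissible \<rho>" and v: "v \<ge> 1" and pos: "Lambda G S v > 0"
    and \<phi>: "\<phi> \<in> low_moment_measures G S \<rho>"
  shows "spectral_profile G \<phi> v
      \<le> 32 * q * \<rho> 0 * (Lambda G S v * integral {0..1 / Lambda G S v powr (1 / 2)} (\<lambda>s. s / \<rho> s))"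
proof -
  define L where "L = Lambda G S v"
  define R where "R = 1 / L powr (1 / 2)"
  define M where "M = nat \<lfloor>R\<rfloor>"
  have L: "0 < L" "L \<le> 1" using pos Lambda_le_1[OF v] by (auto simp: L_def)
  then have R: "R \<ge> 1" "L * R\<^sup>2 = 1"
    by (auto simp: R_def powr_half_sqrt power_divide)
  have M: "real M \<le> R" "R < real M + 1" "real M \<ge> 1"
    using R(1) le_nat_floor[of 1 R] unfolding M_def by (linarith, linarith, simp)
  have \<rho>0: "\<rho> 0 \<ge> 1" using admissible_ge_1[OF \<rho>] by auto
  have supp: "set_pmf \<phi> \<subseteq> carrier G"
    using \<phi> by (simp add: low_moment_measures_def symmetric_prob_def)
  obtain f where f: "fin_supp f" "real (card (support G f)) \<le> v" "ip f f = 1" and E: "energy f \<le> 2 * L"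
    using near_optimal[OF v pos] unfolding L_def .
  have disp: "displacement f y \<le> 16 * q * L * (real (min (word_length G S y) M))\<^sup>2" (is "_ \<le> ?r y")
    if y: "y \<in> carrier G" for y
  proof (cases "word_length G S y \<le> M")
    case True
    have "displacement f y \<le> 2 * q * energy f * (real (word_length G S y))\<^sup>2"
      by (rule displacement_le_energy[OF f(1) y])
    also have "\<dots> \<le> 2 * q * (8 * L) * (real (word_length G S y))\<^sup>2"
      using E L by (intro mult_right_mono mult_left_mono) auto
    finally show ?thesis using True by (simp add: min_def)
  next
    case False
    have "1 = L * R\<^sup>2" using R by simp
    also have "\<dots> \<le> L * (2 * real M)\<^sup>2" using L M by (intro mult_left_mono power_mono) auto
    finally have "1 * 1 \<le> q * (L * (2 * real M)\<^sup>2)"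
      using q_ge_1 by (intro mult_mono) auto
    also have "\<dots> = 4 * q * L * (real M)\<^sup>2" by (simp add: power2_eq_square)
    finally show ?thesis
      using displacement_le[OF f(1) y] False f(3) by (simp add: min_def)
  qed
  have "measure_pmf.expectation \<phi> (displacement f) \<le> measure_pmf.expectation \<phi> ?r"
  proof (rule integral_mono_AE)
    show "integrable (measure_pmf \<phi>) (displacement f)"
      using supp displacement_le[OF f(1)] displacement_nonneg[of f] f(3)
      by (intro measure_pmf.integrable_const_bound[where B = 4]) (auto simp: AE_measure_pmf_iff)
    show "integrable (measure_pmf \<phi>) ?r"
      using L by (intro measure_pmf.integrable_const_bound[where B = "16 * q * L * (real M)\<^sup>2"] AE_I2)
        (auto intro!: mult_left_mono)
    show "AE y in measure_pmf \<phi>. displacement f y \<le> ?r y"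
      using disp supp by (auto simp: AE_measure_pmf_iff)
  qed
  also have "\<dots> = 16 * q * L * measure_pmf.expectation \<phi> (\<lambda>y. (real (min (word_length G S y) M))\<^sup>2)"
    by simp
  also have "\<dots> \<le> 16 * q * L * (4 * \<rho> 0 * integral {0..real M} (\<lambda>s. s / \<rho> s))"
    using L by (intro mult_left_mono truncated_second_moment_le[OF \<rho> \<phi>]) auto
  also have "\<dots> \<le> 16 * q * L * (4 * \<rho> 0 * integral {0..R} (\<lambda>s. s / \<rho> s))"
  proof -
    have "integral {0..real M} (\<lambda>s. s / \<rho> s) \<le> integral {0..R} (\<lambda>s. s / \<rho> s)"
      using M admissible_ge_1[OF \<rho>] 
      by (intro integral_subset_le admissible_integrable[OF \<rho>] ballI divide_nonneg_pos) (auto, fastforce)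
    then show ?thesis using L \<rho>0 by (intro mult_left_mono) auto
  qed
  finally have "dirichlet_form G \<phi> f \<le> 32 * q * \<rho> 0 * (L * integral {0..R} (\<lambda>s. s / \<rho> s))"
    by (simp add: dirichlet_form_eq_expectation[OF f(1) supp] algebra_simps)
  then show ?thesis
    using spectral_profile_le[OF f, of \<phi>] by (simp add: L_def R_def)
qed

lemma return_low_moment:
  assumes "admissible \<rho>"
  shows "return_pmf \<one> \<in> low_moment_measures G S \<rho>"
proof -
  have \<rho>0: "\<rho> 0 \<ge> 1" using admissible_ge_1[OF assms] by auto
  have len: "word_length G S \<one> = 0" using word_length_le[of "[]"] by simp
  have "weak_moment G S \<rho> (return_pmf \<one>) \<le> ennreal (2 * \<rho> 0)"
    unfolding weak_moment_def
  proof (rule SUP_least)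
    fix s :: real assume "s \<in> {0<..}"
    then show "ennreal s * emeasure (measure_pmf (return_pmf \<one>))
        {g \<in> carrier G. s < \<rho> (real (word_length G S g))} \<le> ennreal (2 * \<rho> 0)"
      using \<rho>0 by (auto simp: indicator_def len intro!: ennreal_leI)
  qed
  moreover have "symmetric_prob G (return_pmf \<one>)"
    unfolding symmetric_prob_def
  proof (intro conjI ballI)
    fix g assume "g \<in> carrier G"
    then have "\<one> = inv g \<longleftrightarrow> \<one> = g" by (metis inv_inv inv_one)
    then show "pmf (return_pmf \<one>) (inv g) = pmf (return_pmf \<one>) g"
      by (simp only: pmf_return singleton_iff indicator_def)
  qed simp
  ultimately show ?thesis by (simp add: low_moment_measures_def)
qed

lemma low_moment_supp: "\<phi> \<in> low_moment_measures G S \<rho> \<Longrightarrow> set_pmf \<phi> \<subseteq> carrier G"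
  by (simp add: low_moment_measures_def symmetric_prob_def)

lemma Lambda_tilde_le:
  assumes "admissible \<rho>"
    and "\<And>\<phi>. \<phi> \<in> low_moment_measures G S \<rho> \<Longrightarrow> spectral_profile G \<phi> v \<le> c"
  shows "Lambda_tilde G S \<rho> v \<le> c"
  unfolding Lambda_tilde_def
  using return_low_moment[OF assms(1)] assms(2) by (intro cSUP_least) auto

lemma Lambda_tilde_ge:
  assumes "v \<ge> 1" "\<phi> \<in> low_moment_measures G S \<rho>"
  shows "spectral_profile G \<phi> v \<le> Lambda_tilde G S \<rho> v"
  unfolding Lambda_tilde_def
  using assms spectral_profile_le_1[OF low_moment_supp]
  by (intro cSUP_upper bdd_aboveI2[where M = 1]) auto

end

section \<open>Decay of the simple random walk\<close>

lemma has_sum_finite_sum: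
  fixes f :: "'i \<Rightarrow> 'b \<Rightarrow> real"
  assumes "finite I" "\<And>i. i \<in> I \<Longrightarrow> (f i has_sum c i) A"
  shows "((\<lambda>x. \<Sum>i\<in>I. f i x) has_sum (\<Sum>i\<in>I. c i)) A"
  using assms by (induction rule: finite_induct) (auto intro: has_sum_add)

context marked_group begin

text \<open>
  The operator \<open>P\<close> of the simple random walk, acting by right convolution.
\<close>

definition markov :: "('a \<Rightarrow> real) \<Rightarrow> 'a \<Rightarrow> real" where
  "markov f = (\<lambda>x. (1 / q) * (\<Sum>s\<in>alphabet. translate s f x))"

definition l1 :: "('a \<Rightarrow> real) \<Rightarrow> real" where
  "l1 f = (\<Sum>\<^sub>\<infinity>x\<in>carrier G. \<bar>f x\<bar>)"

lemma alphabetD: "s \<in> alphabet \<Longrightarrow> s \<in> carrier G"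
  using alphabet_carrier by auto

lemma fin_supp_scale: "fin_supp f \<Longrightarrow> fin_supp (\<lambda>x. c * f x)"
  by (erule fin_supp_subset) simp

lemma fin_supp_markov: "fin_supp f \<Longrightarrow> fin_supp (markov f)"
  unfolding markov_def
  by (intro fin_supp_scale fin_supp_sum finite_alphabet fin_supp_translate alphabetD)

lemma fin_supp_markov_iter: "fin_supp f \<Longrightarrow> fin_supp ((markov ^^ n) f)"
  by (induction n) (auto intro: fin_supp_markov)

lemma ip_markov_right:
  assumes "fin_supp h"
  shows "ip h (markov g) = (1 / q) * (\<Sum>s\<in>alphabet. ip h (translate s g))"
  unfolding markov_def ip_scale_right using assms finite_alphabet by (simp add: ip_sum_right)

lemma ip_translates_le:
  assumes "fin_supp f" "y \<in> carrier G" "z \<in> carrier G"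
  shows "ip (translate y f) (translate z f) \<le> ip f f"
  using norm_diff_translates[OF assms]
    ip_self_nonneg[of "\<lambda>x. translate y f x - translate z f x"] by simp

text \<open>
  \<open>\<parallel>g\<parallel>\<^sup>2 - \<parallel>Pg\<parallel>\<^sup>2\<close> is half the average over pairs \<open>(s, t)\<close> of the squared distance between the translates by \<open>s\<close>
  and by \<open>t\<close>. The identity belongs to the alphabet, and the pairs with \<open>s = \<one>\<close> alone already give \<open>E\<^sub>u(g)/q\<close>.
\<close>

lemma energy_dissipation:
  assumes g: "fin_supp g"
  shows "ip (markov g) (markov g) \<le> ip g g - energy g / q"
proof -
  let ?A = "\<lambda>s. (\<Sum>t\<in>alphabet. ip (translate s g) (translate t g))"
  have one: "\<one> \<in> alphabet" by (simp add: alphabet_def)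
  have eq: "ip (markov g) (markov g) = (1 / q) * ((1 / q) * (\<Sum>s\<in>alphabet. ?A s))"
  proof -
    have "ip (markov g) (markov g) = (1 / q) * (\<Sum>s\<in>alphabet. ip (markov g) (translate s g))"
      by (rule ip_markov_right[OF fin_supp_markov[OF g]])
    also have "\<dots> = (1 / q) * (\<Sum>s\<in>alphabet. ip (translate s g) (markov g))"
      by (simp add: ip_commute)
    also have "\<dots> = (1 / q) * (\<Sum>s\<in>alphabet. (1 / q) * ?A s)"
      using ip_markov_right[OF fin_supp_translate[OF alphabetD g]] by simp
    finally show ?thesis by (simp add: sum_distrib_left)
  qed
  have "?A s \<le> q * ip g g" if "s \<in> alphabet" for s
    using sum_mono[of alphabet "\<lambda>t. ip (translate s g) (translate t g)" "\<lambda>_. ip g g"]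
      ip_translates_le[OF g] that alphabetD by simp
  then have "(\<Sum>s\<in>alphabet - {\<one>}. ?A s) \<le> (\<Sum>s\<in>alphabet - {\<one>}. q * ip g g)"
    by (intro sum_mono) auto
  also have "\<dots> = (q - 1) * (q * ip g g)"
    using one finite_alphabet alphabet_nonempty
    by (simp add: card_Diff_singleton of_nat_diff Suc_le_eq card_gt_0_iff)
  finally have rest: "(\<Sum>s\<in>alphabet - {\<one>}. ?A s) \<le> (q - 1) * (q * ip g g)" .
  have "?A \<one> = (\<Sum>t\<in>alphabet. ip g g - displacement g t / 2)"
  proof (rule sum.cong[OF refl])
    fix t assume t: "t \<in> alphabet"
    have "ip (translate \<one> g) (translate t g) = ip g (translate t g)"
      by (rule ip_cong) (auto simp: translate_def)
    then show "ip (translate \<one> g) (translate t g) = ip g g - displacement g t / 2"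
      using displacement_eq[OF g alphabetD[OF t]] by linarith
  qed
  also have "\<dots> = q * ip g g - q * energy g"
    using q_ge_1 by (simp add: energy_eq[OF g] sum_subtractf sum_divide_distrib[symmetric])
  finally have "(\<Sum>s\<in>alphabet. ?A s) \<le> q * (q * ip g g) - q * energy g"
    using rest sum.remove[OF finite_alphabet one, of ?A] by (simp add: algebra_simps)
  then have "(1 / q) * ((1 / q) * (\<Sum>s\<in>alphabet. ?A s))
      \<le> (1 / q) * ((1 / q) * (q * (q * ip g g) - q * energy g))"
    using q_ge_1 by (intro mult_left_mono) auto
  also have "\<dots> = ip g g - energy g / q"
    using q_ge_1 by (simp add: field_simps)
  finally show ?thesis unfolding eq .
qed

lemma l1_nonneg: "0 \<le> l1 f"
  unfolding l1_def by (intro infsum_nonneg) simp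

lemma fin_supp_abs_summable:
  assumes "fin_supp f"
  shows "(\<lambda>x. \<bar>f x\<bar>) summable_on carrier G"
  by (rule fin_supp_summable, rule fin_supp_subset[OF assms]) simp

lemma l1_markov_le:
  assumes f: "fin_supp f"
  shows "l1 (markov f) \<le> l1 f"
proof -
  have tr: "((\<lambda>x. \<bar>translate s f x\<bar>) has_sum l1 f) (carrier G)" if "s \<in> alphabet" for s
  proof -
    have "(\<Sum>\<^sub>\<infinity>x\<in>carrier G. \<bar>translate s f x\<bar>) = l1 f"
      unfolding l1_def translate_def
      by (rule infsum_reindex_bij_betw[OF bij_betw_mult_right[OF alphabetD[OF that]], of "\<lambda>x. \<bar>f x\<bar>"])
    then show ?thesis
      using has_sum_infsum[OF fin_supp_abs_summable[OF fin_supp_translate[OF alphabetD[OF that] f]]] by simp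
  qed
  have hs: "((\<lambda>x. (1 / q) * (\<Sum>s\<in>alphabet. \<bar>translate s f x\<bar>)) has_sum
      (1 / q) * (\<Sum>s\<in>alphabet. l1 f)) (carrier G)"
    by (intro has_sum_cmult_right has_sum_finite_sum finite_alphabet tr)
  have "l1 (markov f) \<le> (\<Sum>\<^sub>\<infinity>x\<in>carrier G. (1 / q) * (\<Sum>s\<in>alphabet. \<bar>translate s f x\<bar>))"
    unfolding l1_def
  proof (rule infsum_mono[OF fin_supp_abs_summable[OF fin_supp_markov[OF f]] has_sum_imp_summable[OF hs]])
    fix x
    have "\<bar>markov f x\<bar> = (1 / q) * \<bar>\<Sum>s\<in>alphabet. translate s f x\<bar>"
      unfolding markov_def abs_mult by simp
    also have "\<dots> \<le> (1 / q) * (\<Sum>s\<in>alphabet. \<bar>translate s f x\<bar>)"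
      by (intro mult_left_mono sum_abs) auto
    finally show "\<bar>markov f x\<bar> \<le> (1 / q) * (\<Sum>s\<in>alphabet. \<bar>translate s f x\<bar>)" .
  qed
  also have "\<dots> = l1 f" using infsumI[OF hs] q_ge_1 by simp
  finally show ?thesis .
qed

lemma l1_markov_iter_le: "fin_supp f \<Longrightarrow> l1 ((markov ^^ n) f) \<le> l1 f"
  by (induction n) (auto intro: order_trans[OF l1_markov_le] fin_supp_markov_iter)

lemma l1_eq_sum:
  assumes "fin_supp f"
  shows "l1 f = (\<Sum>x\<in>support G f. \<bar>f x\<bar>)"
  unfolding l1_def
  by (rule infsumI, rule has_sum_finite_neutralI[OF assms]) (auto simp: support_def)

lemma l1_square_le:
  assumes "fin_supp f"
  shows "(l1 f)\<^sup>2 \<le> real (card (support G f)) * ip f f"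
  using Cauchy_Schwarz_ineq_sum[of "\<lambda>_. 1" "\<lambda>x. \<bar>f x\<bar>" "support G f"]
  by (simp add: l1_eq_sum[OF assms] ip_self_eq_sum[OF assms])

lemma displacement_scale: "displacement (\<lambda>x. c * f x) y = c\<^sup>2 * displacement f y"
proof -
  have "(c * f (x \<otimes> y) - c * f x)\<^sup>2 = c\<^sup>2 * (f (x \<otimes> y) - f x)\<^sup>2" for x
    by (simp add: power2_eq_square algebra_simps)
  then show ?thesis by (simp add: displacement_def infsum_cmult_right')
qed

text \<open>
  The variational definition freed from the normalisation, by homogeneity.
\<close>

lemma Lambda_mult_le_energy:
  assumes f: "fin_supp f" and card: "real (card (support G f)) \<le> w"
  shows "Lambda G S w * ip f f \<le> energy f"
proof (cases "ip f f = 0")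
  case True
  then show ?thesis by (simp add: dirichlet_form_nonneg)
next
  case False
  then have pos: "ip f f > 0" using ip_self_nonneg[of f] by simp
  define c where "c = 1 / sqrt (ip f f)"
  have c: "c \<noteq> 0" "c\<^sup>2 * ip f f = 1" using pos by (auto simp: c_def power_divide)
  let ?g = "\<lambda>x. c * f x"
  have supp: "support G ?g = support G f" using c by (auto simp: support_def)
  have "ip ?g ?g = c * (c * ip f f)"
    by (simp only: ip_scale_right ip_commute[of ?g f])
  then have "Lambda G S w \<le> energy ?g"
    unfolding Lambda_def using f card c
    by (intro spectral_profile_le) (simp_all add: supp power2_eq_square mult.assoc)
  also have "energy ?g = c\<^sup>2 * energy f"
    by (simp add: energy_eq[OF f] energy_eq[OF fin_supp_scale[OF f]] displacement_scale sum_distrib_left)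
  finally have "Lambda G S w * ip f f \<le> c\<^sup>2 * energy f * ip f f"
    using pos by (intro mult_right_mono) auto
  also have "\<dots> = energy f * (c\<^sup>2 * ip f f)" by simp
  finally show ?thesis using c by simp
qed

text \<open>
  Truncate at height \<open>t = \<parallel>g\<parallel>\<^sup>2/(4\<parallel>g\<parallel>\<^sub>1)\<close>. By Markov's inequality \<open>h = (|g| - t)\<^sup>+\<close> has support of size at most
  \<open>\<parallel>g\<parallel>\<^sub>1/t\<close>; it keeps half of the squared norm, because \<open>h\<^sup>2 \<ge> g\<^sup>2 - 2t|g|\<close>; and it does not have more energy
  than \<open>g\<close>, because \<open>r \<mapsto> (|r| - t)\<^sup>+\<close> is \<open>1\<close>-Lipschitz.
\<close>

lemma nash_inequality:
  assumes g: "fin_supp g" and w: "w \<ge> 1" "4 * (l1 g)\<^sup>2 \<le> w * ip g g"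
  shows "Lambda G S w * ip g g / 2 \<le> energy g"
proof (cases "ip g g = 0")
  case True
  then show ?thesis by (simp add: dirichlet_form_nonneg)
next
  case False
  then have pos: "ip g g > 0" using ip_self_nonneg[of g] by simp
  have l1pos: "l1 g > 0"
  proof (rule ccontr)
    assume "\<not> l1 g > 0"
    then have "l1 g = 0" using l1_nonneg[of g] by simp
    then have "(\<Sum>x\<in>support G g. \<bar>g x\<bar>) = 0" by (simp add: l1_eq_sum[OF g])
    then have "\<forall>x\<in>support G g. g x = 0" using g by (simp add: sum_nonneg_eq_0_iff)
    then show False using pos by (simp add: ip_self_eq_sum[OF g])
  qed
  define t where "t = ip g g / (4 * l1 g)"
  have t: "t > 0" using pos l1pos by (simp add: t_def)
  define h where "h = (\<lambda>x. max (\<bar>g x\<bar> - t) 0)"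
  have h: "fin_supp h" by (rule fin_supp_subset[OF g]) (use t in \<open>auto simp: h_def\<close>)
  have supp: "support G h \<subseteq> support G g" using t by (auto simp: support_def h_def)
  have "t * real (card (support G h)) = (\<Sum>x\<in>support G h. t)" by simp
  also have "\<dots> \<le> (\<Sum>x\<in>support G h. \<bar>g x\<bar>)"
    by (intro sum_mono) (auto simp: support_def h_def max_def split: if_splits)
  also have "\<dots> \<le> l1 g"
    unfolding l1_eq_sum[OF g] by (intro sum_mono2 g supp) auto
  finally have "t * real (card (support G h)) \<le> l1 g" .
  then have "real (card (support G h)) \<le> 4 * (l1 g)\<^sup>2 / ip g g"
    using pos l1pos by (simp add: t_def field_simps power2_eq_square)
  also have "\<dots> \<le> w" using w pos by (simp add: field_simps)
  finally have card: "real (card (support G h)) \<le> w" .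
  have "ip g g - 2 * t * l1 g = (\<Sum>x\<in>support G g. (g x)\<^sup>2 - 2 * t * \<bar>g x\<bar>)"
    by (simp add: ip_self_eq_sum[OF g] l1_eq_sum[OF g] sum_subtractf sum_distrib_left)
  also have "\<dots> \<le> (\<Sum>x\<in>support G g. (h x)\<^sup>2)"
  proof (rule sum_mono)
    fix x
    show "(g x)\<^sup>2 - 2 * t * \<bar>g x\<bar> \<le> (h x)\<^sup>2"
    proof (cases "\<bar>g x\<bar> > t")
      case True
      have "(\<bar>g x\<bar> - t)\<^sup>2 = (g x)\<^sup>2 - 2 * t * \<bar>g x\<bar> + t\<^sup>2"
        by (simp add: power2_diff)
      then show ?thesis using True by (simp add: h_def)
    next
      case False
      have "\<bar>g x\<bar> * (\<bar>g x\<bar> - 2 * t) \<le> 0" using False t by (intro mult_nonneg_nonpos) auto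
      moreover have "(g x)\<^sup>2 - 2 * t * \<bar>g x\<bar> = \<bar>g x\<bar> * (\<bar>g x\<bar> - 2 * t)"
        by (simp add: power2_eq_square algebra_simps)
      ultimately show ?thesis by (metis order_trans zero_le_power2)
    qed
  qed
  also have "\<dots> = ip h h"
    unfolding ip_self_eq_sum[OF h] by (intro sum.mono_neutral_right g supp) (auto simp: support_def)
  finally have half: "ip g g / 2 \<le> ip h h" using l1pos by (simp add: t_def)
  have "Lambda G S w * ip g g / 2 \<le> Lambda G S w * ip h h"
    using mult_left_mono[OF half Lambda_nonneg[OF w(1)]] by simp
  also have "\<dots> \<le> energy h" by (rule Lambda_mult_le_energy[OF h card])
  also have "\<dots> \<le> energy g"
    unfolding energy_eq[OF h] energy_eq[OF g]
  proof (intro divide_right_mono sum_mono)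
    fix y assume y: "y \<in> alphabet"
    show "displacement h y \<le> displacement g y"
      unfolding displacement_def
    proof (intro infsum_mono displacement_summable g h alphabetD[OF y])
      fix x
      have "\<bar>h (x \<otimes> y) - h x\<bar> \<le> \<bar>g (x \<otimes> y) - g x\<bar>" by (auto simp: h_def max_def)
      then show "(h (x \<otimes> y) - h x)\<^sup>2 \<le> (g (x \<otimes> y) - g x)\<^sup>2" by (simp add: abs_le_square_iff)
    qed
  qed simp
  finally show ?thesis .
qed

text \<open>
  As long as the squared norm of \<open>g = P\<^sup>n f\<close> exceeds \<open>1/2\<close>, one has \<open>4\<parallel>g\<parallel>\<^sub>1\<^sup>2 \<le> 4v \<le> 8v\<parallel>g\<parallel>\<^sup>2\<close>. The Nash inequality then
  applies at volume \<open>8v\<close>, and each step dissipates at least \<open>\<Lambda>\<^sub>G(8v)/(4q)\<close>.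
\<close>

lemma markov_iter_decay:
  assumes f: "fin_supp f" "ip f f = 1" "real (card (support G f)) \<le> v" and v: "v \<ge> 1"
  shows "ip ((markov ^^ n) f) ((markov ^^ n) f) \<le> max (1 / 2) (1 - real n * Lambda G S (8 * v) / (4 * q))"
proof (induction n)
  case 0
  then show ?case using f by simp
next
  case (Suc n)
  define g where "g = (markov ^^ n) f"
  have g: "fin_supp g" unfolding g_def by (rule fin_supp_markov_iter[OF f(1)])
  have dis: "ip (markov g) (markov g) \<le> ip g g - energy g / q" by (rule energy_dissipation[OF g])
  show ?case
  proof (cases "ip g g \<le> 1 / 2")
    case True
    moreover have "energy g / q \<ge> 0" by (intro divide_nonneg_nonneg dirichlet_form_nonneg) auto
    ultimately show ?thesis using dis by (simp add: g_def[symmetric])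
  next
    case False
    have "(l1 g)\<^sup>2 \<le> (l1 f)\<^sup>2"
      unfolding g_def using l1_markov_iter_le[OF f(1)] l1_nonneg by (intro power_mono)
    also have "\<dots> \<le> v" using l1_square_le[OF f(1)] f by simp
    finally have "4 * (l1 g)\<^sup>2 \<le> 8 * v * (1 / 2)" by simp
    also have "\<dots> \<le> 8 * v * ip g g" using False v by (intro mult_left_mono) auto
    finally have "Lambda G S (8 * v) * ip g g / 2 \<le> energy g"
      using v by (intro nash_inequality[OF g]) auto
    moreover have "Lambda G S (8 * v) * (1 / 2) \<le> Lambda G S (8 * v) * ip g g"
      using False v by (intro mult_left_mono Lambda_nonneg) auto
    ultimately have "Lambda G S (8 * v) / 4 / q \<le> energy g / q"
      by (intro divide_right_mono) auto
    then have "ip (markov g) (markov g) \<le> ip g g - Lambda G S (8 * v) / (4 * q)"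
      using dis by simp
    also have "\<dots> \<le> 1 - real (Suc n) * Lambda G S (8 * v) / (4 * q)"
      using Suc.IH False by (simp add: g_def[symmetric] add_divide_distrib algebra_simps)
    finally show ?thesis by (simp add: g_def)
  qed
qed

section \<open>The lower bound by diluted random walks\<close>

text \<open>
  The law of a product of \<open>2n\<close> independent uniform letters. Letters are added on both sides: every step
  then preserves the symmetry of the law, and it corresponds to one application of \<open>P\<close> in each argument of
  the inner product.
\<close>

primrec walk :: "nat \<Rightarrow> 'a pmf" where
  "walk 0 = return_pmf \<one>"
| "walk (Suc n) = bind_pmf (walk n) (\<lambda>y. bind_pmf (unif G S) (\<lambda>s.
     bind_pmf (unif G S) (\<lambda>t. return_pmf (s \<otimes> y \<otimes> t))))"

lemma finite_walk: "finite (set_pmf (walk n))"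
  by (induction n) (auto simp: set_bind_pmf set_unif finite_alphabet)

lemma walk_word:
  assumes "y \<in> set_pmf (walk n)"
  shows "\<exists>w. set w \<subseteq> letters G S \<and> length w \<le> 2 * n \<and> word_product w = y"
  using assms
proof (induction n arbitrary: y)
  case 0
  then show ?case by (intro exI[of _ "[]"]) simp
next
  case (Suc n)
  then obtain z s t where y: "y = s \<otimes> z \<otimes> t" and z: "z \<in> set_pmf (walk n)"
    and st: "s \<in> alphabet" "t \<in> alphabet"
    by (auto simp: set_bind_pmf set_unif)
  obtain w where w: "set w \<subseteq> letters G S" "length w \<le> 2 * n" "word_product w = z"
    using Suc.IH[OF z] by blast
  have short: "\<exists>u. set u \<subseteq> letters G S \<and> length u \<le> 1 \<and> word_product u = a" if "a \<in> alphabet" for a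
  proof (cases "a = \<one>")
    case True
    then show ?thesis by (intro exI[of _ "[]"]) simp
  next
    case False
    then show ?thesis using that alphabetD[OF that]
      by (intro exI[of _ "[a]"]) (auto simp: alphabet_def)
  qed
  obtain u u' where u: "set u \<subseteq> letters G S" "length u \<le> 1" "word_product u = s"
    and u': "set u' \<subseteq> letters G S" "length u' \<le> 1" "word_product u' = t"
    using short[OF st(1)] short[OF st(2)] by blast
  have sub: "set u \<subseteq> carrier G" "set w \<subseteq> carrier G" "set u' \<subseteq> carrier G"
    using u(1) w(1) u'(1) letters_carrier by auto
  then have "word_product ((u @ w) @ u') = y"
    unfolding y using u(3) w(3) u'(3) by (subst word_product_append; simp add: word_product_append del: foldr_append)
  then show ?case using u w u' by (intro exI[of _ "(u @ w) @ u'"]) (auto simp del: foldr_append)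
qed

lemma walk_carrier: "set_pmf (walk n) \<subseteq> carrier G"
  using walk_word word_product_closed letters_carrier by blast

lemma walk_word_length: "y \<in> set_pmf (walk n) \<Longrightarrow> word_length G S y \<le> 2 * n"
  using walk_word[of y n] word_length_le by (metis order_trans)

lemma bij_inv_alphabet: "bij_betw (m_inv G) alphabet alphabet"
  by (rule bij_betwI[where g = "m_inv G"]) (auto simp: alphabet_inv alphabetD)

lemma unif_inv: "map_pmf (m_inv G) (unif G S) = unif G S"
  unfolding unif_eq
  using map_pmf_of_set_bij_betw[OF bij_inv_alphabet alphabet_nonempty finite_alphabet] .

text \<open>
  Inversion reverses the order of the factors and inverts each of them. Each step adds two letters with the
  same symmetric law on the two sides, so exchanging them restores the order.
\<close>

lemma walk_inv: "map_pmf (m_inv G) (walk n) = walk n"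
proof (induction n)
  case 0
  then show ?case by simp
next
  case (Suc n)
  let ?U = "unif G S"
  have "map_pmf (m_inv G) (walk (Suc n)) = bind_pmf (walk n) (\<lambda>y. bind_pmf ?U (\<lambda>s.
      bind_pmf ?U (\<lambda>t. return_pmf (inv (s \<otimes> y \<otimes> t)))))"
    by (simp add: map_bind_pmf)
  also have "\<dots> = bind_pmf (walk n) (\<lambda>y. bind_pmf ?U (\<lambda>s.
      bind_pmf ?U (\<lambda>t. return_pmf (inv t \<otimes> inv y \<otimes> inv s))))"
    using walk_carrier[of n]
    by (intro bind_pmf_cong refl) (auto simp: set_unif alphabetD inv_mult_group m_assoc)
  also have "\<dots> = bind_pmf (walk n) (\<lambda>y. bind_pmf ?U (\<lambda>t.
      bind_pmf ?U (\<lambda>s. return_pmf (inv t \<otimes> inv y \<otimes> inv s))))"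
    by (intro bind_pmf_cong refl bind_commute_pmf)
  also have "\<dots> = bind_pmf (map_pmf (m_inv G) (walk n)) (\<lambda>y. bind_pmf (map_pmf (m_inv G) ?U) (\<lambda>t.
      bind_pmf (map_pmf (m_inv G) ?U) (\<lambda>s. return_pmf (t \<otimes> y \<otimes> s))))"
    by (simp add: bind_map_pmf)
  finally show ?case by (simp add: Suc.IH unif_inv)
qed

text \<open>
  Invariance under the push-forward by inversion is the form in which symmetry passes through mixtures.
\<close>

lemma symmetric_probI:
  assumes "set_pmf \<phi> \<subseteq> carrier G" "map_pmf (m_inv G) \<phi> = \<phi>"
  shows "symmetric_prob G \<phi>"
  unfolding symmetric_prob_def
proof (intro conjI ballI assms(1))
  fix g assume g: "g \<in> carrier G"
  have inj: "inj_on (m_inv G) (set_pmf \<phi>)"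
    using inv_inj assms(1) inj_on_subset by blast
  have img: "set_pmf \<phi> = m_inv G ` set_pmf \<phi>" using assms(2) set_map_pmf by metis
  show "pmf \<phi> (inv g) = pmf \<phi> g"
  proof (cases "g \<in> set_pmf \<phi>")
    case True
    then show ?thesis using pmf_map_inj[OF inj True] assms(2) by simp
  next
    case False
    have "inv g \<notin> set_pmf \<phi>"
    proof
      assume "inv g \<in> set_pmf \<phi>"
      then have "inv (inv g) \<in> set_pmf \<phi>" using img by blast
      then show False using g False by simp
    qed
    then show ?thesis using False by (simp add: set_pmf_iff)
  qed
qed

lemma expectation_bind_finite:
  fixes h :: "'c \<Rightarrow> real"
  assumes "finite (set_pmf p)" "\<And>x. x \<in> set_pmf p \<Longrightarrow> finite (set_pmf (k x))"
  shows "measure_pmf.expectation (bind_pmf p k) h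
    = measure_pmf.expectation p (\<lambda>x. measure_pmf.expectation (k x) h)"
proof -
  have "measure_pmf.expectation (bind_pmf p k) h
      = (\<Sum>a\<in>set_pmf p. pmf p a *\<^sub>R measure_pmf.expectation (k a) h)"
    by (rule pmf_expectation_bind) (use assms in auto)
  also have "\<dots> = measure_pmf.expectation p (\<lambda>x. measure_pmf.expectation (k x) h)"
    by (rule integral_measure_pmf[symmetric]) (use assms in auto)
  finally show ?thesis .
qed

lemma ip_markov_translate:
  assumes f: "fin_supp f" and g: "fin_supp g" and y: "y \<in> carrier G"
  shows "ip (markov f) (translate y (markov g))
    = (\<Sum>s\<in>alphabet. (\<Sum>t\<in>alphabet. ip f (translate (s \<otimes> y \<otimes> t) g)) / q) / q"
proof -
  have mg: "translate y (markov g) = (\<lambda>x. (1 / q) * (\<Sum>t\<in>alphabet. translate y (translate t g) x))"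
    by (simp add: markov_def translate_def)
  have inner: "ip (translate s f) (translate y (markov g))
      = (\<Sum>t\<in>alphabet. ip f (translate (inv s \<otimes> y \<otimes> t) g)) / q" if s: "s \<in> alphabet" for s
  proof -
    have "ip (translate s f) (translate y (markov g))
        = (1 / q) * (\<Sum>t\<in>alphabet. ip (translate s f) (translate y (translate t g)))"
      unfolding mg ip_scale_right
      using fin_supp_translate[OF alphabetD[OF s] f] finite_alphabet by (simp add: ip_sum_right)
    also have "(\<Sum>t\<in>alphabet. ip (translate s f) (translate y (translate t g)))
        = (\<Sum>t\<in>alphabet. ip f (translate (inv s \<otimes> y \<otimes> t) g))"
    proof (rule sum.cong[OF refl])
      fix t assume t: "t \<in> alphabet"
      have "ip (translate s f) (translate y (translate t g))
          = ip (translate (inv (inv s)) f) (translate y (translate t g))"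
        using alphabetD[OF s] by simp
      also have "\<dots> = ip f (translate (inv s) (translate y (translate t g)))"
        using alphabetD[OF s] by (intro ip_translate_inv) simp
      also have "\<dots> = ip f (translate (inv s \<otimes> y \<otimes> t) g)"
        by (rule ip_cong) (use alphabetD[OF s] alphabetD[OF t] y in \<open>auto simp: translate_def m_assoc\<close>)
      finally show "ip (translate s f) (translate y (translate t g))
          = ip f (translate (inv s \<otimes> y \<otimes> t) g)" .
    qed
    finally show ?thesis by simp
  qed
  have fin: "fin_supp (translate y (markov g))"
    by (intro fin_supp_translate y fin_supp_markov g)
  have "ip (markov f) (translate y (markov g)) = (1 / q) * (\<Sum>s\<in>alphabet. ip (translate s f) (translate y (markov g)))"
    using ip_markov_right[OF fin, of f] by (simp add: ip_commute)
  also have "\<dots> = (1 / q) * (\<Sum>s\<in>alphabet. (\<Sum>t\<in>alphabet. ip f (translate (inv s \<otimes> y \<otimes> t) g)) / q)"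
    using inner by simp
  also have "(\<Sum>s\<in>alphabet. (\<Sum>t\<in>alphabet. ip f (translate (inv s \<otimes> y \<otimes> t) g)) / q)
      = (\<Sum>s\<in>alphabet. (\<Sum>t\<in>alphabet. ip f (translate (s \<otimes> y \<otimes> t) g)) / q)"
    by (rule sum.reindex_bij_betw[OF bij_inv_alphabet, of "\<lambda>s. (\<Sum>t\<in>alphabet. ip f (translate (s \<otimes> y \<otimes> t) g)) / q"])
  finally show ?thesis by simp
qed

text \<open>
  The left letter of each step is moved to the first argument of the inner product by invariance, and
  averaging over the two letters replaces \<open>f\<close> and \<open>g\<close> by \<open>Pf\<close> and \<open>Pg\<close>.
\<close>

lemma expectation_walk:
  assumes "fin_supp f" "fin_supp g"
  shows "measure_pmf.expectation (walk n) (\<lambda>y. ip f (translate y g)) = ip ((markov ^^ n) f) ((markov ^^ n) g)"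
  using assms
proof (induction n arbitrary: f g)
  case 0
  have "ip f (translate \<one> g) = ip f g" by (rule ip_cong) (auto simp: translate_def)
  then show ?case by simp
next
  case (Suc n)
  have unif: "measure_pmf.expectation (unif G S) h = (\<Sum>s\<in>alphabet. h s) / q" for h :: "'a \<Rightarrow> real"
    by (simp add: unif_eq integral_pmf_of_set finite_alphabet alphabet_nonempty)
  have "measure_pmf.expectation (walk (Suc n)) (\<lambda>y. ip f (translate y g))
      = measure_pmf.expectation (walk n) (\<lambda>y.
          (\<Sum>s\<in>alphabet. (\<Sum>t\<in>alphabet. ip f (translate (s \<otimes> y \<otimes> t) g)) / q) / q)"
    by (simp add: expectation_bind_finite finite_walk set_bind_pmf set_unif finite_alphabet unif sum_divide_distrib[symmetric])
  also have "\<dots> = measure_pmf.expectation (walk n) (\<lambda>y. ip (markov f) (translate y (markov g)))"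
    using walk_carrier[of n] ip_markov_translate[OF Suc.prems]
    by (intro integral_cong_AE) (auto simp: AE_measure_pmf_iff)
  also have "\<dots> = ip ((markov ^^ n) (markov f)) ((markov ^^ n) (markov g))"
    by (intro Suc.IH fin_supp_markov Suc.prems)
  finally show ?case by (simp add: funpow_swap1)
qed

lemma dirichlet_form_walk:
  assumes f: "fin_supp f"
  shows "dirichlet_form G (walk n) f = ip f f - ip ((markov ^^ n) f) ((markov ^^ n) f)"
proof -
  have "measure_pmf.expectation (walk n) (displacement f)
      = measure_pmf.expectation (walk n) (\<lambda>y. 2 * ip f f - 2 * ip f (translate y f))"
    using walk_carrier[of n] displacement_eq[OF f]
    by (intro integral_cong_AE) (auto simp: AE_measure_pmf_iff)
  also have "\<dots> = 2 * ip f f - 2 * ip ((markov ^^ n) f) ((markov ^^ n) f)"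
    using expectation_walk[OF f f, of n] integrable_measure_pmf_finite[OF finite_walk]
    by (subst Bochner_Integration.integral_diff) auto
  finally show ?thesis
    by (simp add: dirichlet_form_eq_expectation[OF f walk_carrier])
qed

text \<open>
  Dilution by the point mass at the identity multiplies the Dirichlet form by \<open>\<epsilon>\<close>, and the tail of the word
  length as well.
\<close>

definition lazy_walk :: "real \<Rightarrow> nat \<Rightarrow> 'a pmf" where
  "lazy_walk \<epsilon> n = bind_pmf (bernoulli_pmf \<epsilon>) (\<lambda>b. if b then walk n else return_pmf \<one>)"

lemma lazy_walk_carrier: "set_pmf (lazy_walk \<epsilon> n) \<subseteq> carrier G"
  using walk_carrier[of n] by (auto simp: lazy_walk_def set_bind_pmf split: if_splits)

lemma lazy_walk_symmetric: "symmetric_prob G (lazy_walk \<epsilon> n)"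
proof (rule symmetric_probI[OF lazy_walk_carrier])
  show "map_pmf (m_inv G) (lazy_walk \<epsilon> n) = lazy_walk \<epsilon> n"
    unfolding lazy_walk_def map_bind_pmf by (intro bind_pmf_cong) (auto simp: walk_inv)
qed

lemma dirichlet_form_lazy_walk:
  assumes f: "fin_supp f" and \<epsilon>: "0 \<le> \<epsilon>" "\<epsilon> \<le> 1"
  shows "dirichlet_form G (lazy_walk \<epsilon> n) f = \<epsilon> * dirichlet_form G (walk n) f"
proof -
  have "measure_pmf.expectation (lazy_walk \<epsilon> n) (displacement f)
      = measure_pmf.expectation (walk n) (displacement f) * \<epsilon>"
    unfolding lazy_walk_def using \<epsilon>
    by (subst expectation_bind_finite) (auto simp: finite_walk displacement_one intro: finite_subset)
  then show ?thesis
    by (simp add: dirichlet_form_eq_expectation[OF f] lazy_walk_carrier walk_carrier)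
qed

text \<open>
  For \<open>s < \<rho>(0)\<close> the trivial bound suffices. For larger \<open>s\<close> the identity does not contribute, so the event has
  mass at most \<open>1/\<rho>(2n)\<close>; and it is empty up to null sets when \<open>s \<ge> \<rho>(2n)\<close>, the walk being confined to the
  ball of radius \<open>2n\<close>.
\<close>

lemma lazy_walk_low_moment:
  assumes \<rho>: "admissible \<rho>"
  shows "lazy_walk (1 / \<rho> (2 * real n)) n \<in> low_moment_measures G S \<rho>"
proof -
  define \<epsilon> where "\<epsilon> = 1 / \<rho> (2 * real n)"
  have \<rho>n: "\<rho> (2 * real n) \<ge> 1" and \<rho>0: "\<rho> 0 \<ge> 1" using admissible_ge_1[OF \<rho>] by auto
  then have \<epsilon>: "0 \<le> \<epsilon>" "\<epsilon> \<le> 1" by (auto simp: \<epsilon>_def)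
  have "weak_moment G S \<rho> (lazy_walk \<epsilon> n) \<le> ennreal (2 * \<rho> 0)"
    unfolding weak_moment_def
  proof (rule SUP_least)
    fix s :: real assume s: "s \<in> {0<..}"
    let ?A = "{g \<in> carrier G. s < \<rho> (real (word_length G S g))}"
    have em: "emeasure (measure_pmf (lazy_walk \<epsilon> n)) ?A
        = ennreal \<epsilon> * emeasure (measure_pmf (walk n)) ?A + ennreal (1 - \<epsilon>) * indicator ?A \<one>"
      unfolding lazy_walk_def emeasure_bind_pmf using \<epsilon> by (simp add: mult.commute)
    show "ennreal s * emeasure (measure_pmf (lazy_walk \<epsilon> n)) ?A \<le> ennreal (2 * \<rho> 0)"
    proof (cases "s < \<rho> 0")
      case True
      have "ennreal s * emeasure (measure_pmf (lazy_walk \<epsilon> n)) ?A \<le> ennreal s * 1"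
        by (intro mult_left_mono measure_pmf.emeasure_le_1) auto
      also have "\<dots> \<le> ennreal (2 * \<rho> 0)" using True \<rho>0 by (auto intro!: ennreal_leI)
      finally show ?thesis .
    next
      case False
      have len: "word_length G S \<one> = 0" using word_length_le[of "[]"] by simp
      have ind: "indicator ?A \<one> = (0 :: ennreal)" using False by (simp add: len)
      show ?thesis
      proof (cases "s < \<rho> (2 * real n)")
        case True
        have "emeasure (measure_pmf (lazy_walk \<epsilon> n)) ?A
            = ennreal \<epsilon> * emeasure (measure_pmf (walk n)) ?A"
          by (simp add: em ind)
        also have "\<dots> \<le> ennreal \<epsilon> * 1"
          by (intro mult_left_mono measure_pmf.emeasure_le_1) auto
        finally have "ennreal s * emeasure (measure_pmf (lazy_walk \<epsilon> n)) ?A \<le> ennreal s * (ennreal \<epsilon> * 1)"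
          by (rule mult_left_mono) auto
        also have "\<dots> = ennreal (s * \<epsilon>)" using s \<epsilon> by (simp add: ennreal_mult)
        also have "s * \<epsilon> \<le> 1" using True \<rho>n by (simp add: \<epsilon>_def)
        then have "ennreal (s * \<epsilon>) \<le> ennreal (2 * \<rho> 0)"
          using \<rho>0 by (intro ennreal_leI) simp
        finally show ?thesis .
      next
        case beyond: False
        have "\<not> s < \<rho> (real (word_length G S g))" if "g \<in> set_pmf (walk n)" for g
          using walk_word_length[OF that] beyond
            admissible_mono[OF \<rho>, of "real (word_length G S g)" "2 * real n"] by simp
        then have "emeasure (measure_pmf (walk n)) ?A = 0"
          by (auto simp: measure_pmf.emeasure_eq_measure measure_pmf_zero_iff)
        then show ?thesis unfolding em ind by simp
      qed
    qed
  qed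
  then show ?thesis
    using lazy_walk_symmetric by (simp add: low_moment_measures_def \<epsilon>_def)
qed

text \<open>
  With this many steps every competitor has lost half of its squared norm, so its Dirichlet form for the
  walk is at least \<open>1/2\<close>.
\<close>

lemma Lambda_tilde_lower_bound:
  assumes \<rho>: "admissible \<rho>" and v: "v \<ge> 1" and n: "real n * Lambda G S (8 * v) \<ge> 2 * q"
  shows "1 / (2 * \<rho> (2 * real n)) \<le> Lambda_tilde G S \<rho> v"
proof -
  define \<epsilon> where "\<epsilon> = 1 / \<rho> (2 * real n)"
  have \<epsilon>: "0 \<le> \<epsilon>" "\<epsilon> \<le> 1" using admissible_ge_1[OF \<rho>, of "2 * real n"] by (auto simp: \<epsilon>_def)
  have "\<epsilon> * (1 / 2) \<le> spectral_profile G (lazy_walk \<epsilon> n) v"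
  proof (rule spectral_profile_greatest[OF v])
    fix f assume f: "fin_supp f" "real (card (support G f)) \<le> v" "ip f f = 1"
    have "real n * Lambda G S (8 * v) / (4 * q) \<ge> 1 / 2"
      using n q_ge_1 by (simp add: field_simps)
    then have "ip ((markov ^^ n) f) ((markov ^^ n) f) \<le> 1 / 2"
      using markov_iter_decay[OF f(1,3,2) v, of n] by simp
    then have "1 / 2 \<le> dirichlet_form G (walk n) f"
      by (simp add: dirichlet_form_walk[OF f(1)] f(3))
    then show "\<epsilon> * (1 / 2) \<le> dirichlet_form G (lazy_walk \<epsilon> n) f"
      unfolding dirichlet_form_lazy_walk[OF f(1) \<epsilon>] using \<epsilon> by (intro mult_left_mono)
  qed
  also have "\<dots> \<le> Lambda_tilde G S \<rho> v"
    using lazy_walk_low_moment[OF \<rho>] unfolding \<epsilon>_def by (rule Lambda_tilde_ge[OF v])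
  finally show ?thesis by (simp add: \<epsilon>_def)
qed

end

section \<open>Square doubling moment functions\<close>

text \<open>
  The single property of the moment function that makes the upper and the lower bound agree.
\<close>

definition square_doubling :: "(real \<Rightarrow> real) \<Rightarrow> bool" where
  "square_doubling \<rho> \<longleftrightarrow> (\<exists>D\<ge>1. \<forall>t\<ge>0. \<rho> (t\<^sup>2) \<le> D * \<rho> t)"

text \<open>
  Put \<open>h(t) = \<rho>(t)/t\<close>. Then \<open>h(t\<^sup>2) \<le> (D/t)h(t) \<le> h(t)\<close> for \<open>t \<ge> D\<close>, so repeated square roots bring any
  argument into a bounded interval without decreasing \<open>h\<close>.
\<close>

lemma square_doubling_linear_growth:
  assumes \<rho>: "admissible \<rho>" and "square_doubling \<rho>"
  shows "\<exists>C\<ge>1. \<forall>t\<ge>1. \<rho> t \<le> C * t"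
proof -
  obtain D where D: "D \<ge> 1" "\<And>t. t \<ge> 0 \<Longrightarrow> \<rho> (t\<^sup>2) \<le> D * \<rho> t"
    using assms(2) by (auto simp: square_doubling_def)
  \<comment> \<open>\<open>K \<ge> D\<close> makes squaring harmless for \<open>h\<close> beyond \<open>K\<close>; \<open>K \<ge> 2\<close> makes the powers of \<open>K\<close> unbounded.\<close>
  define K where "K = max D 2"
  define C where "C = \<rho> (K\<^sup>2)"
  have C: "C \<ge> 1" unfolding C_def by (rule admissible_ge_1[OF \<rho>]) simp
  have K: "K \<ge> 2" "D \<le> K" by (auto simp: K_def)
  have small: "\<rho> t \<le> C * t" if "1 \<le> t" "t \<le> K\<^sup>2" for t
  proof -
    have "\<rho> t \<le> C * 1" unfolding C_def using that admissible_mono[OF \<rho>, of t "K\<^sup>2"] by simp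
    also have "\<dots> \<le> C * t" using C that by (intro mult_left_mono) auto
    finally show ?thesis .
  qed
  have "\<rho> t \<le> C * t" if "1 \<le> t" "t \<le> (K\<^sup>2) ^ (2 ^ n)" for t n
    using that
  proof (induction n arbitrary: t)
    case 0
    then show ?case using small by simp
  next
    case (Suc n)
    show ?case
    proof (cases "t \<le> K\<^sup>2")
      case True
      then show ?thesis using small Suc.prems by simp
    next
      case False
      define r where "r = sqrt t"
      have r: "r\<^sup>2 = t" "r \<ge> 1" using Suc.prems by (auto simp: r_def)
      have "K \<le> r" unfolding r_def using False by (intro real_le_rsqrt) simp
      have "t \<le> ((K\<^sup>2) ^ (2 ^ n))\<^sup>2"
        using Suc.prems(2) by (simp add: power_mult[symmetric] mult.commute)
      then have "r \<le> (K\<^sup>2) ^ (2 ^ n)"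
        unfolding r_def using K by (intro real_le_lsqrt) auto
      then have "\<rho> r \<le> C * r" using Suc.IH r by simp
      have "\<rho> t \<le> D * \<rho> r" using D(2)[of r] r by simp
      also have "\<dots> \<le> r * (C * r)"
        using D(1) K \<open>K \<le> r\<close> \<open>\<rho> r \<le> C * r\<close> admissible_ge_1[OF \<rho>, of r] r by (intro mult_mono) auto
      also have "\<dots> = C * t" using r by (simp add: power2_eq_square)
      finally show ?thesis .
    qed
  qed
  moreover have "\<exists>n. t \<le> (K\<^sup>2) ^ (2 ^ n)" for t
  proof -
    have K2: "K\<^sup>2 \<ge> 2\<^sup>2" using K by (intro power_mono) auto
    obtain n where "t < (K\<^sup>2) ^ n" using real_arch_pow[of "K\<^sup>2" t] K2 by auto
    also have "\<dots> \<le> (K\<^sup>2) ^ (2 ^ n)"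
      using K2 by (intro power_increasing) (auto simp: less_imp_le less_exp)
    finally show ?thesis using less_imp_le by blast
  qed
  ultimately show ?thesis using C by blast
qed

lemma square_doubling_dilation:
  assumes \<rho>: "admissible \<rho>" and "square_doubling \<rho>" and c: "c \<ge> 0"
  shows "\<exists>D\<ge>1. \<forall>t\<ge>0. \<rho> (c * t) \<le> D * \<rho> t"
proof -
  obtain D where D: "D \<ge> 1" "\<And>t. t \<ge> 0 \<Longrightarrow> \<rho> (t\<^sup>2) \<le> D * \<rho> t"
    using assms(2) by (auto simp: square_doubling_def)
  define D' where "D' = max D (\<rho> (c\<^sup>2))"
  have "\<rho> (c * t) \<le> D' * \<rho> t" if t: "t \<ge> 0" for t
  proof -
    have pos: "\<rho> t \<ge> 1" by (rule admissible_ge_1[OF \<rho> t])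
    have "\<rho> (c * t) \<le> D * \<rho> t \<or> \<rho> (c * t) \<le> \<rho> (c\<^sup>2) * \<rho> t"
    proof (cases "c \<le> t")
      case True
      have "\<rho> (c * t) \<le> \<rho> (t\<^sup>2)"
        using True t c by (intro admissible_mono[OF \<rho>]) (auto simp: power2_eq_square mult_right_mono)
      then show ?thesis using D(2)[OF t] by simp
    next
      case False
      have "\<rho> (c * t) \<le> \<rho> (c\<^sup>2) * 1"
        using False t c admissible_mono[OF \<rho>, of "c * t" "c\<^sup>2"] by (simp add: power2_eq_square mult_left_mono)
      also have "\<dots> \<le> \<rho> (c\<^sup>2) * \<rho> t"
        using pos admissible_ge_1[OF \<rho>, of "c\<^sup>2"] by (intro mult_left_mono) auto
      finally show ?thesis by simp
    qed
    moreover have "D * \<rho> t \<le> D' * \<rho> t" "\<rho> (c\<^sup>2) * \<rho> t \<le> D' * \<rho> t"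
      using pos by (auto simp: D'_def intro!: mult_right_mono)
    ultimately show ?thesis by linarith
  qed
  then show ?thesis using D(1) by (intro exI[of _ D']) (auto simp: D'_def)
qed

text \<open>
  With \<open>1/L = R\<^sup>2\<close>, split the integral over \<open>[0, R]\<close> at \<open>r\<close>, the square root of \<open>R\<close>. The part above \<open>r\<close> is at most
  \<open>R\<^sup>2/\<rho>(r)\<close>, and \<open>\<rho>(r)\<close> is comparable with \<open>\<rho>(R\<^sup>2) = \<rho>(1/L)\<close>. The part below \<open>r\<close> is at most \<open>r\<^sup>2 = R\<close>, hence
  contributes \<open>1/R\<close>, and \<open>\<rho>(R\<^sup>2) \<le> D\<^sup>2\<rho>(r) \<le> CD\<^sup>2R\<close> by the linear growth of \<open>\<rho>\<close>.
\<close>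

lemma square_doubling_integral_bound:
  assumes \<rho>: "admissible \<rho>" and sd: "square_doubling \<rho>"
  shows "\<exists>C>0. \<forall>L. 0 < L \<and> L \<le> 1 \<longrightarrow>
    L * integral {0..1 / L powr (1 / 2)} (\<lambda>s. s / \<rho> s) \<le> C * (1 / \<rho> (1 / L))"
proof -
  obtain D where D: "D \<ge> 1" "\<And>t. t \<ge> 0 \<Longrightarrow> \<rho> (t\<^sup>2) \<le> D * \<rho> t"
    using sd by (auto simp: square_doubling_def)
  obtain C where C: "C \<ge> 1" "\<And>t. t \<ge> 1 \<Longrightarrow> \<rho> t \<le> C * t"
    using square_doubling_linear_growth[OF \<rho> sd] by auto
  have linear: "integral {a..b} (\<lambda>s. s / \<rho> s) \<le> b\<^sup>2 / \<rho> a" if "0 \<le> a" "a \<le> b" for a b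
  proof -
    have \<rho>a: "\<rho> a \<ge> 1" using admissible_ge_1[OF \<rho> that(1)] .
    have "integral {a..b} (\<lambda>s. s / \<rho> s) \<le> integral {a..b} (\<lambda>s. b / \<rho> a)"
    proof (rule integral_le[OF admissible_integrable[OF \<rho> that(1)]])
      fix s assume "s \<in> {a..b}"
      then show "s / \<rho> s \<le> b / \<rho> a"
        using that \<rho>a admissible_mono[OF \<rho>, of a s] by (intro frac_le) auto
    qed auto
    also have "\<dots> = (b - a) * (b / \<rho> a)" using that by simp
    also have "\<dots> \<le> b * (b / \<rho> a)" using that \<rho>a by (intro mult_right_mono) auto
    finally show ?thesis by (simp add: power2_eq_square)
  qed
  have "L * integral {0..1 / L powr (1 / 2)} (\<lambda>s. s / \<rho> s) \<le> (D\<^sup>2 * C + D\<^sup>2) * (1 / \<rho> (1 / L))"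
    if L: "0 < L" "L \<le> 1" for L
  proof -
    define R where "R = 1 / L powr (1 / 2)"
    define r where "r = sqrt R"
    have R: "R \<ge> 1" "L = 1 / R\<^sup>2" "1 / L = R\<^sup>2"
      using L by (auto simp: R_def powr_half_sqrt power_divide)
    have r: "1 \<le> r" "r \<le> R" "r\<^sup>2 = R"
      using R(1) real_le_lsqrt[of R R] self_le_power[of R 2] by (auto simp: r_def)
    have \<rho>r: "\<rho> r \<ge> 1" using r admissible_ge_1[OF \<rho>] by simp
    have "\<rho> (R\<^sup>2) \<le> D * \<rho> R" using R D by simp
    also have "\<dots> \<le> D * (D * \<rho> r)" using D(2)[of r] D(1) r by (intro mult_left_mono) auto
    finally have up: "\<rho> (R\<^sup>2) \<le> D\<^sup>2 * \<rho> r" by (simp add: power2_eq_square)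
    also have "\<dots> \<le> D\<^sup>2 * (C * R)"
      using order_trans[OF C(2)[OF r(1)] mult_left_mono[OF r(2), of C]] C(1)
      by (intro mult_left_mono) auto
    finally have up': "\<rho> (R\<^sup>2) \<le> D\<^sup>2 * C * R" by simp
    have \<rho>R: "\<rho> (R\<^sup>2) \<ge> 1" by (rule admissible_ge_1[OF \<rho>]) simp
    have "integral {0..r} (\<lambda>s. s / \<rho> s) \<le> r\<^sup>2 / \<rho> 0" using linear[of 0 r] r by simp
    also have "\<dots> \<le> R / 1"
      unfolding r(3) using R admissible_ge_1[OF \<rho>, of 0] by (intro divide_left_mono) auto
    finally have low: "integral {0..r} (\<lambda>s. s / \<rho> s) \<le> R" by simp
    have high: "integral {r..R} (\<lambda>s. s / \<rho> s) \<le> R\<^sup>2 / \<rho> r" using linear[of r R] r by simp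
    have "integral {0..R} (\<lambda>s. s / \<rho> s) = integral {0..r} (\<lambda>s. s / \<rho> s) + integral {r..R} (\<lambda>s. s / \<rho> s)"
      using r admissible_integrable[OF \<rho>]
      by (intro Henstock_Kurzweil_Integration.integral_combine[symmetric]) auto
    with low high have "L * integral {0..R} (\<lambda>s. s / \<rho> s) \<le> L * (R + R\<^sup>2 / \<rho> r)"
      using L by (intro mult_left_mono) auto
    also have "\<dots> = 1 / R + 1 / \<rho> r"
      using R(1) unfolding R(2) by (simp add: field_simps power2_eq_square)
    also have "1 / R \<le> D\<^sup>2 * C * (1 / \<rho> (R\<^sup>2))" using up' \<rho>R R(1) by (simp add: field_simps)
    also have "1 / \<rho> r \<le> D\<^sup>2 * (1 / \<rho> (R\<^sup>2))" using up \<rho>R \<rho>r by (simp add: field_simps)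
    finally show ?thesis unfolding R(3) R_def[symmetric] by (simp add: algebra_simps)
  qed
  moreover have "D\<^sup>2 * C + D\<^sup>2 > 0" using C(1) D(1) by (intro add_pos_pos mult_pos_pos) auto
  ultimately show ?thesis by blast
qed

lemma iter_log_ge_1: "t \<ge> 0 \<Longrightarrow> 1 \<le> iter_log k t"
  by (induction k) auto

lemma iter_log_mono: "0 \<le> s \<Longrightarrow> s \<le> t \<Longrightarrow> iter_log k s \<le> iter_log k t"
proof (induction k)
  case (Suc k)
  then show ?case using iter_log_ge_1[of s k] by (simp add: ln_mono)
qed simp

lemma iter_log_continuous: "continuous_on {0..} (iter_log k)"
proof (induction k)
  case 0
  have "iter_log 0 = (\<lambda>t. 1 + t)" by (simp add: fun_eq_iff)
  then show ?case by (simp add: continuous_intros)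
next
  case (Suc k)
  have "iter_log (Suc k) = (\<lambda>t. 1 + ln (iter_log k t))" by (simp add: fun_eq_iff)
  moreover have "continuous_on {0..} (\<lambda>t. 1 + ln (iter_log k t))"
    using iter_log_ge_1[of _ k] by (intro continuous_intros Suc.IH) (fastforce simp: not_le)
  ultimately show ?case by simp
qed

text \<open>
  Starts with \<open>1 + t\<^sup>2 \<le> (1 + t)\<^sup>2\<close>; every further logarithm turns the factor \<open>2\<close> into a summand \<open>ln 2 < 1\<close>.
\<close>

lemma iter_log_square:
  assumes "t \<ge> 0"
  shows "iter_log (Suc k) (t\<^sup>2) \<le> 2 * iter_log (Suc k) t"
proof (induction k)
  case 0
  have "ln (1 + t\<^sup>2) \<le> ln ((1 + t)\<^sup>2)"
    using assms by (intro ln_mono) (auto simp: power2_eq_square algebra_simps add_pos_nonneg)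
  also have "\<dots> = 2 * ln (1 + t)" using assms by (simp add: ln_realpow)
  finally show ?case by simp
next
  case (Suc k)
  have ge: "1 \<le> iter_log (Suc k) t" "1 \<le> iter_log (Suc k) (t\<^sup>2)"
    using assms by (auto intro!: iter_log_ge_1 simp del: iter_log.simps)
  have "ln (iter_log (Suc k) (t\<^sup>2)) \<le> ln (2 * iter_log (Suc k) t)"
    using Suc.IH ge by (intro ln_mono) auto
  also have "\<dots> = ln 2 + ln (iter_log (Suc k) t)" using ge by (intro ln_mult_pos) auto
  also have "\<dots> \<le> 1 + 2 * ln (iter_log (Suc k) t)"
    using ln_2_less_1 ge ln_ge_zero[OF ge(1)] by linarith
  finally show ?case by (subst (1 2) iter_log.simps(2)) simp
qed

lemma iter_log_powr_admissible:
  assumes "\<epsilon> > 0"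
  shows "admissible (\<lambda>t. iter_log k t powr \<epsilon>)"
  unfolding admissible_def
proof (intro conjI allI impI)
  show "continuous_on {0..} (\<lambda>t. iter_log k t powr \<epsilon>)"
    using iter_log_ge_1[of _ k] by (intro continuous_on_powr iter_log_continuous continuous_on_const) fastforce
  show "mono_on {0..} (\<lambda>t. iter_log k t powr \<epsilon>)"
    using assms iter_log_ge_1[of _ k] iter_log_mono[of _ _ k]
    by (intro mono_onI powr_mono2) (auto intro: order_trans[OF zero_le_one])
  show "1 \<le> iter_log k t powr \<epsilon>" if "t \<ge> 0" for t
    using assms iter_log_ge_1[OF that] by (intro ge_one_powr_ge_zero) auto
qed

lemma iter_log_powr_square_doubling:
  assumes "\<epsilon> > 0" "k \<ge> 1"
  shows "square_doubling (\<lambda>t. iter_log k t powr \<epsilon>)"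
  unfolding square_doubling_def
proof (intro exI conjI allI impI)
  show "1 \<le> 2 powr \<epsilon>" using assms by (intro ge_one_powr_ge_zero) auto
  fix t :: real assume t: "t \<ge> 0"
  obtain m where "k = Suc m" using assms(2) by (cases k) auto
  then have "iter_log k (t\<^sup>2) powr \<epsilon> \<le> (2 * iter_log k t) powr \<epsilon>"
    using assms(1) iter_log_square[OF t, of m] iter_log_ge_1[of "t\<^sup>2" k] by (intro powr_mono2) auto
  also have "\<dots> = 2 powr \<epsilon> * iter_log k t powr \<epsilon>" 
    using iter_log_ge_1[OF t, of k] by (intro powr_mult)
  finally show "iter_log k (t\<^sup>2) powr \<epsilon> \<le> 2 powr \<epsilon> * iter_log k t powr \<epsilon>" .
qed

text \<open>
  Let \<open>L(t)\<close> be the integral of \<open>g(s) = 1/((1+s)l(s))\<close> over \<open>[t, \<infinity>)\<close>. Substituting \<open>s = u\<^sup>2\<close> expresses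
  \<open>L(t\<^sup>2)\<close> through \<open>2u g(u\<^sup>2)\<close>, which dominates \<open>g(u)\<close> up to a constant as \<open>l(u\<^sup>2) \<le> 2c\<^sub>1 l(u)\<close>. So
  \<open>L(t) \<le> C L(t\<^sup>2)\<close> for large \<open>t\<close>, that is, \<open>M = 1/L\<close> satisfies \<open>M(t\<^sup>2) \<le> C M(t)\<close>. The equivalence of \<open>\<rho>\<close> and \<open>M\<close>
  only allows dilated arguments, but these are absorbed by further squarings.
\<close>

lemma square_doubling_of_slowly_varying:
  assumes \<rho>: "admissible \<rho>" and l: "admissible l" and sv: "slowly_varying l"
    and int: "(\<lambda>s. 1 / ((1 + s) * l s)) integrable_on {0..}"
    and pow: "dominated (\<lambda>t. l (t powr 2)) l"
    and equiv: "dom_equiv \<rho> (\<lambda>t. inverse (integral {t..} (\<lambda>s. 1 / ((1 + s) * l s))))"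
  shows "square_doubling \<rho>"
proof -
  define g where "g = (\<lambda>s. 1 / ((1 + s) * l s))"
  define L where "L = (\<lambda>t. integral {t..} g)"
  have lpos: "l s \<ge> 1" if "s \<ge> 0" for s using admissible_ge_1[OF l that] .
  have gpos: "g s > 0" if "s \<ge> 0" for s using lpos[OF that] that by (simp add: g_def)
  have abs0: "g absolutely_integrable_on {0..}"
    using int gpos by (intro nonnegative_absolutely_integrable_1) (auto simp: g_def[symmetric] less_imp_le)
  have absint: "g absolutely_integrable_on A" if "A \<in> sets lebesgue" "A \<subseteq> {0..}" for A
    using set_integrable_subset[OF abs0 that] .
  then have gint: "g integrable_on {t..}" "g integrable_on {t..u}" if "t \<ge> 0" for t u
    using that by (auto intro!: set_lebesgue_integral_eq_integral(1))
  have Lpos: "L t > 0" if t: "t \<ge> 0" for t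
  proof -
    define c where "c = 1 / ((2 + t) * l (t + 1))"
    have "0 < c" using t lpos[of "t + 1"] by (simp add: c_def)
    also have "c = integral {t..t + 1} (\<lambda>_. c)" by simp
    also have "\<dots> \<le> integral {t..t + 1} g"
    proof (intro integral_le gint t)
      fix s assume s: "s \<in> {t..t + 1}"
      then show "c \<le> g s"
        unfolding c_def g_def using t lpos[of s] admissible_mono[OF l, of s "t + 1"]
        by (intro divide_left_mono mult_mono mult_pos_pos) auto
    qed auto
    also have "\<dots> \<le> L t"
      unfolding L_def using t gpos by (intro integral_subset_le gint) (auto simp: less_imp_le)
    finally show ?thesis .
  qed
  have Lanti: "L u \<le> L t" if "0 \<le> t" "t \<le> u" for t u
    unfolding L_def using that gpos by (intro integral_subset_le gint) (auto simp: less_imp_le)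
  obtain c1 c2 where c: "c1 > 0" "c2 > 0" and ev1: "eventually (\<lambda>t. l (t powr 2) \<le> c1 * l (c2 * t)) at_top"
    using pow by (auto simp: dominated_def)
  have "((\<lambda>t. l (c2 * t) / l t) \<longlongrightarrow> 1) at_top" using sv c by (simp add: slowly_varying_def)
  then have ev2: "eventually (\<lambda>t. l (c2 * t) / l t < 2) at_top" by (rule order_tendstoD) simp
  have "eventually (\<lambda>t. 1 \<le> t \<and> l (t powr 2) \<le> c1 * l (c2 * t) \<and> l (c2 * t) / l t < 2) at_top"
    using ev1 ev2 eventually_ge_at_top[of 1] by eventually_elim auto
  then obtain T where T': "\<And>t. t \<ge> T \<Longrightarrow> 1 \<le> t \<and> l (t powr 2) \<le> c1 * l (c2 * t) \<and> l (c2 * t) / l t < 2"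
    by (auto simp: eventually_at_top_linorder)
  have T1: "T \<ge> 1" using T'[of T] by simp
  have lsq: "l (u\<^sup>2) \<le> 2 * c1 * l u" if "u \<ge> T" for u
  proof -
    have u: "u \<ge> 1" "l u \<ge> 1" using that T1 lpos[of u] by auto
    have "l (u\<^sup>2) \<le> c1 * l (c2 * u)" using T'[OF that] u by (simp add: powr_numeral)
    also have "\<dots> \<le> c1 * (2 * l u)"
      using T'[OF that] u c by (intro mult_left_mono) (auto simp: field_simps)
    finally show ?thesis by simp
  qed
  have Lsq: "L t \<le> 2 * c1 * L (t\<^sup>2)" if t: "t \<ge> T" for t
  proof -
    have t0: "t \<ge> 1" using t T1 by simp
    have img: "(\<lambda>x. x\<^sup>2) ` {t..} = {t\<^sup>2..}"
    proof (intro equalityI subsetI)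
      fix y assume y: "y \<in> {t\<^sup>2..}"
      then have "t \<le> sqrt y" "(sqrt y)\<^sup>2 = y"
        using t0 order_trans[OF zero_le_power2[of t], of y] by (auto intro: real_le_rsqrt)
      then show "y \<in> (\<lambda>x. x\<^sup>2) ` {t..}" by (intro image_eqI[of _ _ "sqrt y"]) auto
    qed (use t0 in \<open>auto intro!: power_mono\<close>)
    have "(\<lambda>x. \<bar>2 * x\<bar> * g (x\<^sup>2)) absolutely_integrable_on {t..} \<and>
        integral {t..} (\<lambda>x. \<bar>2 * x\<bar> * g (x\<^sup>2)) = L (t\<^sup>2)
      \<longleftrightarrow> g absolutely_integrable_on ((\<lambda>x. x\<^sup>2) ` {t..}) \<and> integral ((\<lambda>x. x\<^sup>2) ` {t..}) g = L (t\<^sup>2)"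
    proof (rule has_absolute_integral_change_of_variables_1')
      show "inj_on (\<lambda>x. x\<^sup>2) {t..}" using t0 by (intro inj_onI) (simp add: power2_eq_iff_nonneg)
    qed (auto intro!: derivative_eq_intros)
    moreover have "g absolutely_integrable_on {t\<^sup>2..}"
      by (rule absint) (auto intro: order_trans[OF zero_le_power2])
    ultimately have sub: "(\<lambda>x. \<bar>2 * x\<bar> * g (x\<^sup>2)) absolutely_integrable_on {t..}"
      "integral {t..} (\<lambda>x. \<bar>2 * x\<bar> * g (x\<^sup>2)) = L (t\<^sup>2)"
      unfolding img by (simp_all add: L_def)
    have "L t \<le> integral {t..} (\<lambda>x. 2 * c1 * (\<bar>2 * x\<bar> * g (x\<^sup>2)))"
      unfolding L_def
    proof (rule integral_le)
      show "g integrable_on {t..}" using gint t0 by simp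
      show "(\<lambda>x. 2 * c1 * (\<bar>2 * x\<bar> * g (x\<^sup>2))) integrable_on {t..}"
        using set_lebesgue_integral_eq_integral(1)[OF sub(1)]
        by (rule integrable_on_mult_right)
      fix u assume "u \<in> {t..}"
      then have u: "u \<ge> T" "u \<ge> 1" using t T1 by auto
      have pos: "l u \<ge> 1" "l (u\<^sup>2) \<ge> 1" using lpos u by auto
      have "1 / (1 + u) \<le> 2 * u / (1 + u\<^sup>2)"
        using u mult_mono[of 1 u 1 u] by (simp add: field_simps power2_eq_square add_pos_nonneg)
      moreover have "1 / l u \<le> 2 * c1 / l (u\<^sup>2)" using lsq[OF u(1)] pos by (simp add: field_simps)
      ultimately have "(1 / (1 + u)) * (1 / l u) \<le> (2 * u / (1 + u\<^sup>2)) * (2 * c1 / l (u\<^sup>2))"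
        using u pos by (intro mult_mono) auto
      then show "g u \<le> 2 * c1 * (\<bar>2 * u\<bar> * g (u\<^sup>2))" using u by (simp add: g_def mult_ac)
    qed
    also have "\<dots> = 2 * c1 * L (t\<^sup>2)" by (simp add: sub(2))
    finally show ?thesis .
  qed
  define C where "C = max 1 (2 * c1)"
  define M where "M = (\<lambda>t. inverse (L t))"
  have C: "C \<ge> 1" by (simp add: C_def)
  have Mpos: "M t > 0" if "t \<ge> 0" for t using Lpos[OF that] by (simp add: M_def)
  have Mmono: "M t \<le> M u" if "0 \<le> t" "t \<le> u" for t u
    using Lanti[OF that] Lpos[of u] that by (simp add: M_def le_imp_inverse_le)
  have Msq: "M (t\<^sup>2) \<le> C * M t" if "t \<ge> T" for t
  proof -
    have pos: "L t > 0" "L (t\<^sup>2) > 0" using Lpos that T1 by auto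
    have "L t \<le> C * L (t\<^sup>2)"
      using Lsq[OF that] by (rule order_trans) (use pos in \<open>auto simp: C_def intro!: mult_right_mono\<close>)
    then show ?thesis using pos by (simp add: M_def field_simps)
  qed
  have Mpow8: "M (x ^ 8) \<le> C ^ 3 * M x" if x: "x \<ge> T" for x
  proof -
    have sq: "y\<^sup>2 \<ge> T" if "y \<ge> T" for y
      using that T1 self_le_power[of y 2] by (meson order_trans zero_less_numeral)
    have "M (((x\<^sup>2)\<^sup>2)\<^sup>2) \<le> C * (C * (C * M x))"
      using C by (intro order_trans[OF Msq] mult_left_mono Msq sq x) auto
    then show ?thesis by (simp add: power3_eq_cube mult.assoc flip: power_mult)
  qed
  have equiv': "dominated \<rho> M" "dominated M \<rho>"
    using equiv by (simp_all add: dom_equiv_def M_def L_def g_def)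
  obtain a b where ab: "a > 0" "b > 0" "eventually (\<lambda>t. \<rho> t \<le> a * M (b * t)) at_top"
    using equiv'(1) by (auto simp: dominated_def)
  obtain a' b' where ab': "a' > 0" "b' > 0" "eventually (\<lambda>t. M t \<le> a' * \<rho> (b' * t)) at_top"
    using equiv'(2) by (auto simp: dominated_def)
  have lim: "filterlim (\<lambda>t. t / b') at_top at_top" "filterlim (\<lambda>t::real. t\<^sup>2) at_top at_top"
    using ab'(2) by real_asymp+
  have "eventually (\<lambda>t. \<rho> (t\<^sup>2) \<le> a * M (b * t\<^sup>2)) at_top"
    using eventually_compose_filterlim[OF ab(3) lim(2)] .
  moreover have "eventually (\<lambda>t. M (t / b') \<le> a' * \<rho> t) at_top"
    using eventually_compose_filterlim[OF ab'(3) lim(1)] ab'(2) by simp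
  moreover have "eventually (\<lambda>t. t / b' \<ge> T) at_top"
    using lim(1) by (simp add: filterlim_at_top)
  \<comment> \<open>The exponent 8 is three squarings; any power greater than 2 absorbs the constants \<open>b\<close> and \<open>b'\<close>.\<close>
  moreover have "eventually (\<lambda>t. b * t\<^sup>2 \<le> (t / b') ^ 8) at_top"
    using ab(2) ab'(2) by real_asymp
  ultimately have "eventually (\<lambda>t. \<rho> (t\<^sup>2) \<le> a * a' * C ^ 3 * \<rho> t) at_top"
  proof eventually_elim
    case (elim t)
    have "\<rho> (t\<^sup>2) \<le> a * M (b * t\<^sup>2)" using elim by simp
    also have "\<dots> \<le> a * M ((t / b') ^ 8)" using elim ab by (intro mult_left_mono Mmono) auto
    also have "\<dots> \<le> a * (C ^ 3 * M (t / b'))" using elim ab by (intro mult_left_mono Mpow8) auto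
    also have "\<dots> \<le> a * (C ^ 3 * (a' * \<rho> t))" using elim ab C by (intro mult_left_mono) auto
    finally show ?case by (simp add: mult_ac)
  qed
  then obtain T0 where T0: "\<And>t. t \<ge> T0 \<Longrightarrow> \<rho> (t\<^sup>2) \<le> a * a' * C ^ 3 * \<rho> t"
    by (auto simp: eventually_at_top_linorder)
  define D where "D = max (\<rho> (T0\<^sup>2)) (a * a' * C ^ 3)"
  have "\<rho> (t\<^sup>2) \<le> D * \<rho> t" if t: "t \<ge> 0" for t
  proof -
    have pos: "\<rho> t \<ge> 1" using admissible_ge_1[OF \<rho> t] .
    have "\<rho> (t\<^sup>2) \<le> \<rho> (T0\<^sup>2) * \<rho> t \<or> \<rho> (t\<^sup>2) \<le> a * a' * C ^ 3 * \<rho> t"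
    proof (cases "t \<ge> T0")
      case False
      then have "\<rho> (t\<^sup>2) \<le> \<rho> (T0\<^sup>2) * 1"
        using t by (simp add: admissible_mono[OF \<rho>] power_mono)
      also have "\<dots> \<le> \<rho> (T0\<^sup>2) * \<rho> t"
        using pos admissible_ge_1[OF \<rho>, of "T0\<^sup>2"] by (intro mult_left_mono) auto
      finally show ?thesis by simp
    qed (use T0 in auto)
    moreover have "\<rho> (T0\<^sup>2) * \<rho> t \<le> D * \<rho> t" "a * a' * C ^ 3 * \<rho> t \<le> D * \<rho> t"
      using pos by (auto simp: D_def intro!: mult_right_mono)
    ultimately show ?thesis by linarith
  qed
  moreover have "D \<ge> 1" using admissible_ge_1[OF \<rho>, of "T0\<^sup>2"] by (simp add: D_def)
  ultimately show ?thesis by (auto simp: square_doubling_def)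
qed

section \<open>Comparison of the profiles\<close>

lemma dominated_if_eventually_0:
  assumes "eventually (\<lambda>t. f t = 0) at_top" "eventually (\<lambda>t. g t = 0) at_top"
  shows "dominated f g"
  unfolding dominated_def
proof (intro exI conjI)
  show "eventually (\<lambda>t. f t \<le> 1 * g (1 * t)) at_top"
    using assms by eventually_elim simp
qed simp_all

context marked_group begin

text \<open>
  Once \<open>v\<close> is at least the order of the group, the constant function is a competitor.
\<close>

lemma eventually_0_if_finite:
  assumes fin: "finite (carrier G)" and \<rho>: "admissible \<rho>"
  shows "eventually (\<lambda>v. Lambda G S v = 0) at_top"
    and "eventually (\<lambda>v. Lambda_tilde G S \<rho> v = 0) at_top"
proof -
  show "eventually (\<lambda>v. Lambda G S v = 0) at_top"
    using eventually_ge_at_top[of "real (card (carrier G))"]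
    by eventually_elim
      (simp add: Lambda_def spectral_profile_eq_0_if_finite[OF fin] set_unif alphabet_carrier)
  show "eventually (\<lambda>v. Lambda_tilde G S \<rho> v = 0) at_top"
    using eventually_ge_at_top[of "real (card (carrier G))"]
  proof eventually_elim
    case (elim v)
    have "spectral_profile G \<phi> v = 0" if "\<phi> \<in> low_moment_measures G S \<rho>" for \<phi>
      using spectral_profile_eq_0_if_finite[OF fin elim low_moment_supp[OF that]] .
    then have "(\<lambda>\<phi>. spectral_profile G \<phi> v) ` low_moment_measures G S \<rho> = {0}"
      using return_low_moment[OF \<rho>] by auto
    then show ?case by (simp add: Lambda_tilde_def)
  qed
qed

lemma Lambda_tilde_dominated_integral:
  assumes \<rho>: "admissible \<rho>"
  shows "dominated (Lambda_tilde G S \<rho>)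
    (\<lambda>v. if Lambda G S v = 0 then 0
         else Lambda G S v * integral {0..1 / Lambda G S v powr (1 / 2)} (\<lambda>s. s / \<rho> s))"
    (is "dominated _ ?g")
proof (cases "finite (carrier G)")
  case True
  show ?thesis
    using eventually_0_if_finite[OF True \<rho>]
    by (intro dominated_if_eventually_0) (auto elim: eventually_mono)
next
  case False
  have "Lambda_tilde G S \<rho> v \<le> 32 * q * \<rho> 0 * ?g (1 * v)" if v: "v \<ge> 1" for v
  proof (rule Lambda_tilde_le[OF \<rho>])
    fix \<phi> assume "\<phi> \<in> low_moment_measures G S \<rho>"
    then show "spectral_profile G \<phi> v \<le> 32 * q * \<rho> 0 * ?g (1 * v)"
      using spectral_profile_le_integral[OF \<rho> v Lambda_pos_if_infinite[OF False v]]
        Lambda_pos_if_infinite[OF False v] by simp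
  qed
  then have "eventually (\<lambda>v. Lambda_tilde G S \<rho> v \<le> 32 * q * \<rho> 0 * ?g (1 * v)) at_top"
    by (rule eventually_at_top_linorderI)
  moreover have "32 * q * \<rho> 0 > 0" using q_ge_1 admissible_ge_1[OF \<rho>, of 0] by simp
  ultimately show ?thesis unfolding dominated_def by (meson zero_less_one)
qed

text \<open>
  The upper bound holds at the same volume. The lower bound compares \<open>v\<close> with \<open>v/8\<close>, and uses a walk with
  \<open>2n \<le> 6q/\<Lambda>\<^sub>G(v)\<close> letters; the constant \<open>6q\<close> is absorbed by square doubling.
\<close>

lemma Lambda_tilde_equiv:
  assumes \<rho>: "admissible \<rho>" and sd: "square_doubling \<rho>"
  shows "dom_equiv (Lambda_tilde G S \<rho>)
    (\<lambda>v. if Lambda G S v = 0 then 0 else 1 / \<rho> (1 / Lambda G S v))"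
    (is "dom_equiv _ ?g")
proof (cases "finite (carrier G)")
  case True
  then show ?thesis
    unfolding dom_equiv_def using eventually_0_if_finite[OF True \<rho>]
    by (intro conjI dominated_if_eventually_0) (auto elim: eventually_mono)
next
  case False
  note pos = Lambda_pos_if_infinite[OF False]
  obtain C where C: "C > 0" and int: "\<And>L. 0 < L \<Longrightarrow> L \<le> 1 \<Longrightarrow>
      L * integral {0..1 / L powr (1 / 2)} (\<lambda>s. s / \<rho> s) \<le> C * (1 / \<rho> (1 / L))"
    using square_doubling_integral_bound[OF \<rho> sd] by blast
  have c: "32 * q * \<rho> 0 > 0" using q_ge_1 admissible_ge_1[OF \<rho>, of 0] by simp
  have "Lambda_tilde G S \<rho> v \<le> (32 * q * \<rho> 0 * C) * ?g (1 * v)" if v: "v \<ge> 1" for v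
  proof (rule Lambda_tilde_le[OF \<rho>])
    fix \<phi> assume "\<phi> \<in> low_moment_measures G S \<rho>"
    then have "spectral_profile G \<phi> v \<le> 32 * q * \<rho> 0 *
        (Lambda G S v * integral {0..1 / Lambda G S v powr (1 / 2)} (\<lambda>s. s / \<rho> s))"
      by (rule spectral_profile_le_integral[OF \<rho> v pos[OF v]])
    also have "\<dots> \<le> 32 * q * \<rho> 0 * (C * (1 / \<rho> (1 / Lambda G S v)))"
      using c by (intro mult_left_mono int pos v Lambda_le_1) auto
    finally show "spectral_profile G \<phi> v \<le> (32 * q * \<rho> 0 * C) * ?g (1 * v)"
      using pos[OF v] by (simp add: mult.assoc)
  qed
  then have "eventually (\<lambda>v. Lambda_tilde G S \<rho> v \<le> (32 * q * \<rho> 0 * C) * ?g (1 * v)) at_top"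
    by (rule eventually_at_top_linorderI)
  then have upper: "dominated (Lambda_tilde G S \<rho>) ?g"
    unfolding dominated_def using mult_pos_pos[OF c C] by (meson zero_less_one)
  obtain D where D: "D \<ge> 1" "\<And>t. t \<ge> 0 \<Longrightarrow> \<rho> (6 * q * t) \<le> D * \<rho> t"
    using square_doubling_dilation[OF \<rho> sd, of "6 * q"] q_ge_1 by auto
  have "?g v \<le> (2 * D) * Lambda_tilde G S \<rho> ((1 / 8) * v)" if v: "v \<ge> 8" for v
  proof -
    define L where "L = Lambda G S v"
    have L: "0 < L" "L \<le> 1" using pos[of v] Lambda_le_1[of v] v by (auto simp: L_def)
    define n where "n = nat \<lceil>2 * q / L\<rceil>"
    have n: "2 * q / L \<le> real n" "real n \<le> 2 * q / L + 1"
      using L by (auto simp: n_def of_nat_ceiling)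
    have \<rho>L: "\<rho> (1 / L) \<ge> 1" and \<rho>n: "\<rho> (2 * real n) \<ge> 1" using admissible_ge_1[OF \<rho>] L by auto
    have "L \<le> q" using L q_ge_1 by linarith
    then have "1 \<le> q / L" using L by (simp add: field_simps)
    then have "2 * real n \<le> 6 * q * (1 / L)" using n by simp
    then have "\<rho> (2 * real n) \<le> D * \<rho> (1 / L)"
      using D(2)[of "1 / L"] admissible_mono[OF \<rho>, of "2 * real n" "6 * q * (1 / L)"] L by simp
    then have "1 / \<rho> (1 / L) \<le> (2 * D) * (1 / (2 * \<rho> (2 * real n)))"
      using \<rho>L \<rho>n by (simp add: field_simps)
    also have "\<dots> \<le> (2 * D) * Lambda_tilde G S \<rho> ((1 / 8) * v)"
    proof (intro mult_left_mono Lambda_tilde_lower_bound[OF \<rho>])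
      show "2 * q \<le> real n * Lambda G S (8 * (1 / 8 * v))"
        using n(1) L by (simp add: L_def field_simps)
    qed (use v D in auto)
    finally show ?thesis using L by (simp add: L_def)
  qed
  then have "eventually (\<lambda>v. ?g v \<le> (2 * D) * Lambda_tilde G S \<rho> ((1 / 8) * v)) at_top"
    by (rule eventually_at_top_linorderI)
  moreover have "2 * D > 0" "(1 / 8 :: real) > 0" using D by auto
  ultimately have "dominated ?g (Lambda_tilde G S \<rho>)" unfolding dominated_def by blast
  with upper show ?thesis by (simp add: dom_equiv_def)
qed

end

theorem theorem1p7:
  fixes G :: "('a, 'm) monoid_scheme" and S :: "'a list"
  assumes "group G" and "generating_tuple G S"
  shows
    "(\<forall>\<rho>. admissible \<rho> \<longrightarrow>
        dominated (Lambda_tilde G S \<rho>)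
          (\<lambda>v. if Lambda G S v = 0 then 0
               else Lambda G S v * integral {0..1 / Lambda G S v powr (1 / 2)} (\<lambda>s. s / \<rho> s)) \<and>
        (\<forall>l. admissible l \<and> slowly_varying l \<and>
             (\<lambda>s. 1 / ((1 + s) * l s)) integrable_on {0..} \<and>
             (\<forall>a>0. dom_equiv (\<lambda>t. l (t powr a)) l) \<and>
             dom_equiv \<rho> (\<lambda>t. inverse (integral {t..} (\<lambda>s. 1 / ((1 + s) * l s)))) \<longrightarrow>
           dom_equiv (Lambda_tilde G S \<rho>)
             (\<lambda>v. if Lambda G S v = 0 then 0 else 1 / \<rho> (1 / Lambda G S v)))) \<and>
     (\<forall>k\<ge>1. \<forall>\<epsilon>>0.
        dom_equiv (Lambda_tilde G S (\<lambda>t. iter_log k t powr \<epsilon>))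
          (\<lambda>v. if Lambda G S v = 0 then 0 else 1 / iter_log k (1 / Lambda G S v) powr \<epsilon>))"
proof -
  interpret group G by fact
  interpret marked_group G S by unfold_locales fact
  show ?thesis
  proof (intro conjI allI impI)
    fix \<rho> :: "real \<Rightarrow> real" and l
    assume \<rho>: "admissible \<rho>"
    then show "dominated (Lambda_tilde G S \<rho>)
          (\<lambda>v. if Lambda G S v = 0 then 0
               else Lambda G S v * integral {0..1 / Lambda G S v powr (1 / 2)} (\<lambda>s. s / \<rho> s))"
      by (rule Lambda_tilde_dominated_integral)
    assume l: "admissible l \<and> slowly_varying l \<and>
             (\<lambda>s. 1 / ((1 + s) * l s)) integrable_on {0..} \<and>
             (\<forall>a>0. dom_equiv (\<lambda>t. l (t powr a)) l) \<and>
             dom_equiv \<rho> (\<lambda>t. inverse (integral {t..} (\<lambda>s. 1 / ((1 + s) * l s))))"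
    then have "dominated (\<lambda>t. l (t powr 2)) l" by (simp add: dom_equiv_def)
    with l have "square_doubling \<rho>"
      by (intro square_doubling_of_slowly_varying[OF \<rho>, of l]) auto
    then show "dom_equiv (Lambda_tilde G S \<rho>)
             (\<lambda>v. if Lambda G S v = 0 then 0 else 1 / \<rho> (1 / Lambda G S v))"
      by (rule Lambda_tilde_equiv[OF \<rho>])
  next
    fix k :: nat and \<epsilon> :: real
    assume "1 \<le> k" "0 < \<epsilon>"
    then show "dom_equiv (Lambda_tilde G S (\<lambda>t. iter_log k t powr \<epsilon>))
          (\<lambda>v. if Lambda G S v = 0 then 0 else 1 / iter_log k (1 / Lambda G S v) powr \<epsilon>)"
      by (intro Lambda_tilde_equiv iter_log_powr_admissible iter_log_powr_square_doubling)
  qed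
qed

end
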